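(* Consider the X-REGO algorithm for functions with low effective dimension (described in the context), with $\mathcal{X}=\mathbb{R}^D$, accuracy tolerance $\epsilon>0$ and $0<\lambda<\epsilon$. Suppose that: (1) $f:\mathbb{R}^D\to\mathbb{R}$ is Lipschitz continuous with constant $L>0$ with respect to the Euclidean norm; (2) there is $\rho_{lb}>0$ such that for all $k\ge1$ there exists $\rho^k\in[\rho_{lb},1]$ (here $k$ is an index, not a power) with $\mathbb{P}[S^k=1\mid\mathcal{F}^{k-1/2}]\ge\rho^k$; (3) $f$ has effective dimension $d_e<D$, with effective subspace spanned by the columns of the orthonormal matrix $U\in\mathbb{R}^{D\times d_e}$; (4) for a global minimizer $x^*$ of $f$ and some suitably chosen constant $R_{\max}>(\epsilon-\lambda)/L$, $\|U^Tp^k-U^Tx^*\|\le R_{\max}$ for all $k\ge0$ (for all realizations of $p^k$); (5) $1\le d_{lb}\le d_e$. Let $k_{\max}=d_e-d_{lb}+1$ be the index of the first embedding of dimension $d_e$. Then $$\mathbb{P}[f(x_{opt}^{k_{\max}})\le f^*+\epsilon]\ >\ \rho^{k_{\max}},$$ where $\rho^{k}$ is the probability of success of the solver for the $k$th reduced problem, as in (2). In particular, if the reduced problem is solved exactly, then $f(x_{opt}^{k_{\max}})\le f^*+\epsilon$ with probability one. For $1\le k<k_{\max}$, we have $$\mathbb{P}[f(x^k_{opt})\le f^*+\epsilon]\ \ge\ 1-(1-\rho_{lb}\tau_{lb})^k,$$ where $\tau_{lb}=\tau(r_{\min}^{\mathrm{eff}},d_{lb},d_e)$ with $r_{\min}^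{\mathrm{eff}}=(\epsilon-\lambda)/(LR_{\max})$.
   Context: $f^*:=\min_{x\in\mathbb{R}^D}f(x)$ (attained). A function $f:\mathbb{R}^D\to\mathbb{R}$ has effective dimension $d_e<D$ if there exists a linear subspace $\mathcal{T}$ (the effective subspace) of dimension $d_e$ such that $f(x_\top+x_\perp)=f(x_\top)$ for all $x_\top\in\mathcal{T}$, $x_\perp\in\mathcal{T}^\perp$, and $d_e$ is the smallest integer with this property. The algorithm as a stochastic process: $p^0$ is a random vector in $\mathbb{R}^D$, $d^1=d_{lb}$ and $d^{k+1}=d^k+1$. For $k\ge1$: $A^k$ is a $D\times d^k$ Gaussian matrix (independent standard normal entries), drawn independently of the past $\mathcal{F}^{k-1}$; the reduced problem is $f^k_{min}=\min_{y\in\mathbb{R}^{d^k}}f(A^ky+p^{k-1})$; a (deterministic or stochastic) solver returns a random vector $y^k\in\mathbb{R}^{d^k}$; one sets $x^k:=A^ky^k+p^{k-1}$; and a random vector $p^k\in\mathbb{R}^D$ is chosen (deterministically or randomly, possibly depending on the past). $x^k_{opt}:=\arg\min\{f(x^1),\dots,f(x^k)\}$, i.e. a point among $x^1,\dots,x^k$ with smallest value of $f$. "Solved exactly" means $f(A^ky^k+p^{k-1})=f^k_{min}$. $S^k:=\mathbf{1}\{f(A^ky^k+p^{k-1})\le f^k_{min}+\lambda\}$. $\mathcal{F}^0=\sigma(p^0)$, $\mathcal{F}^k=\sigma(A^1,\dots,A^k,y^1,\dots,y^k,p^0,\dots,p^k)$, $\mathcal{F}^{k-1/2}=\sigma(A^1,\dots,A^k,y^1,\dots,y^{k-1},p^0,\dots,p^{k-1})$.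 For $0<r<1$ and integers $1\le d<N$, $$\tau(r,d,N):=\begin{cases}(N-1)\binom{\frac{N-2}{2}}{\frac{N-1}{2}}\displaystyle\int_0^{\arcsin(r)}\sin^{N-2}(x)\,dx & \text{if } d=1,\\[2mm] \binom{\frac{N-2}{2}}{\frac{N-d}{2}}\,r^{N-d}(1-r^2)^{\frac{d-2}{2}} & \text{if } 1<d<N,\end{cases}$$ where $\binom{i}{j}=\frac{\Gamma(i+1)}{\Gamma(j+1)\Gamma(i-j+1)}$ for real $i,j$ (if $d_{lb}=d_e$ there is no $k$ with $1\le k<k_{\max}$, so $\tau_{lb}$ is not needed).
   Formalization: The strict bound P[...] > ρ^{k_max} is proved only when k_max > 1 and ρ^{k_max} < 1, and as ≥ in all cases; the strict bound is false if ρ^{k_max} = 1 and can fail with equality if k_max = 1. *)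

theory Defs
  imports "HOL-Probability.Probability"
begin

section \<open>Functions of low effective dimension\<close>

definition constant_off :: "(real^'n \<Rightarrow> real) \<Rightarrow> (real^'n) set \<Rightarrow> bool" where
  "constant_off f T \<longleftrightarrow>
     subspace T \<and> (\<forall>u\<in>T. \<forall>v\<in>orthogonal_comp T. f (u + v) = f u)"

definition has_effective_dim :: "(real^'n \<Rightarrow> real) \<Rightarrow> nat \<Rightarrow> (real^'n) set \<Rightarrow> bool" where
  "has_effective_dim f d T \<longleftrightarrow>
     d < CARD('n) \<and> dim T = d \<and> constant_off f T \<and>
     (\<forall>T'. constant_off f T' \<longrightarrow> d \<le> dim T')"

section \<open>The reduced problems\<close>

text \<open>
  The dimension of the embeddings changes with the iteration. A matrix with rows indexed
  by the type \<^typ>\<open>'n\<close> and \<open>d\<close> columns is therefore a function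
  \<^typ>\<open>'n \<Rightarrow> nat \<Rightarrow> real\<close>, and a vector of length \<open>d\<close> a function \<^typ>\<open>nat \<Rightarrow> real\<close>;
  only the column indices and components below \<open>d\<close> are ever used.
\<close>

definition mat_vec :: "nat \<Rightarrow> ('n::finite \<Rightarrow> nat \<Rightarrow> real) \<Rightarrow> (nat \<Rightarrow> real) \<Rightarrow> real^'n" where
  "mat_vec d B y = (\<chi> i. \<Sum>j<d. B i j * y j)"

text \<open>
  The minimum is written as an infimum, which agrees with it whenever it is attained. The
  reals carry no least element, so the infimum is meaningful only for \<open>f\<close> bounded below, e.g.
  when \<open>f\<close> has a global minimizer.
\<close>

definition reduced_min ::
  "(real^'n \<Rightarrow> real) \<Rightarrow> nat \<Rightarrow> ('n::finite \<Rightarrow> nat \<Rightarrow> real) \<Rightarrow> real^'n \<Rightarrow> real" where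
  "reduced_min f d B q = (INF y. f (mat_vec d B y + q))"

section \<open>The X-REGO process\<close>

definition emb_dim :: "nat \<Rightarrow> nat \<Rightarrow> nat" where
  "emb_dim dlb k = dlb + (k - 1)"

definition sigma_gen :: "'w measure \<Rightarrow> ('w \<Rightarrow> real) set \<Rightarrow> 'w measure" where
  "sigma_gen M Xs = sigma (space M) {X -` B \<inter> space M | X B. X \<in> Xs \<and> B \<in> sets borel}"

definition entries_A ::
  "nat \<Rightarrow> (nat \<Rightarrow> 'w \<Rightarrow> 'n::finite \<Rightarrow> nat \<Rightarrow> real) \<Rightarrow> nat \<Rightarrow> ('w \<Rightarrow> real) set" where
  "entries_A dlb A k = {\<lambda>\<omega>. A k \<omega> i j | i j. j < emb_dim dlb k}"

definition entries_y ::
  "nat \<Rightarrow> (nat \<Rightarrow> 'w \<Rightarrow> nat \<Rightarrow> real) \<Rightarrow> nat \<Rightarrow> ('w \<Rightarrow> real) set" where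
  "entries_y dlb y k = {\<lambda>\<omega>. y k \<omega> j | j. j < emb_dim dlb k}"

definition entries_p :: "(nat \<Rightarrow> 'w \<Rightarrow> real^'n) \<Rightarrow> nat \<Rightarrow> ('w \<Rightarrow> real) set" where
  "entries_p p k = {\<lambda>\<omega>. p k \<omega> $ i | i. True}"

text \<open>The \<open>\<sigma>\<close>-algebras \<open>F\<^sup>k\<close> (all \<open>k\<close>) and \<open>F\<^sup>k\<^sup>-\<^sup>1\<^sup>/\<^sup>2\<close> (\<open>k \<ge> 1\<close>).\<close>

definition past where
  "past M dlb A y p k = sigma_gen M
     ((\<Union>i\<in>{1..k}. entries_A dlb A i) \<union> (\<Union>i\<in>{1..k}. entries_y dlb y i) \<union>
      (\<Union>i\<in>{0..k}. entries_p p i))"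

definition half_past where
  "half_past M dlb A y p k = sigma_gen M
     ((\<Union>i\<in>{1..k}. entries_A dlb A i) \<union> (\<Union>i\<in>{1..<k}. entries_y dlb y i) \<union>
      (\<Union>i\<in>{0..<k}. entries_p p i))"

locale x_rego = prob_space M
  for M :: "'w measure" +
  fixes dlb :: nat
    and A :: "nat \<Rightarrow> 'w \<Rightarrow> 'n::finite \<Rightarrow> nat \<Rightarrow> real"
    and y :: "nat \<Rightarrow> 'w \<Rightarrow> nat \<Rightarrow> real"
    and p :: "nat \<Rightarrow> 'w \<Rightarrow> real^'n"
  assumes dlb_pos: "1 \<le> dlb"
    and p_rv: "\<And>k. p k \<in> borel_measurable M"
    and y_rv: "\<And>k j. 1 \<le> k \<Longrightarrow> j < emb_dim dlb k \<Longrightarrow> (\<lambda>\<omega>. y k \<omega> j) \<in> borel_measurable M"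
    and A_normal: "\<And>k i j. 1 \<le> k \<Longrightarrow> j < emb_dim dlb k \<Longrightarrow>
          distributed M lborel (\<lambda>\<omega>. A k \<omega> i j) std_normal_density"
    and A_indep: "\<And>k. 1 \<le> k \<Longrightarrow>
          indep_vars (\<lambda>_. borel) (\<lambda>(i, j) \<omega>. A k \<omega> i j) (UNIV \<times> {..<emb_dim dlb k})"
    and A_indep_past: "\<And>k. 1 \<le> k \<Longrightarrow>
          indep_set (sets (sigma_gen M (entries_A dlb A k))) (sets (past M dlb A y p (k - 1)))"

definition iterate where
  "iterate dlb A y p k \<omega> = mat_vec (emb_dim dlb k) (A k \<omega>) (y k \<omega>) + p (k - 1) \<omega>"

definition reduced_min_at where
  "reduced_min_at f dlb A p k \<omega> = reduced_min f (emb_dim dlb k) (A k \<omega>) (p (k - 1) \<omega>)"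

definition solver_success :: "(real^'n \<Rightarrow> real) \<Rightarrow> real \<Rightarrow> nat \<Rightarrow>
    (nat \<Rightarrow> 'w \<Rightarrow> 'n::finite \<Rightarrow> nat \<Rightarrow> real) \<Rightarrow> (nat \<Rightarrow> 'w \<Rightarrow> nat \<Rightarrow> real) \<Rightarrow>
    (nat \<Rightarrow> 'w \<Rightarrow> real^'n) \<Rightarrow> nat \<Rightarrow> 'w \<Rightarrow> real" where
  "solver_success f lam dlb A y p k \<omega> =
     of_bool (f (iterate dlb A y p k \<omega>) \<le> reduced_min_at f dlb A p k \<omega> + lam)"

section \<open>The lower bound \<open>\<tau>\<close>\<close>

definition real_binomial :: "real \<Rightarrow> real \<Rightarrow> real" where
  "real_binomial i j = Gamma (i + 1) / (Gamma (j + 1) * Gamma (i - j + 1))"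

text \<open>Meant for \<open>0 < r < 1\<close> and \<open>1 \<le> d < N\<close>; the value is irrelevant otherwise.\<close>

definition tau :: "real \<Rightarrow> nat \<Rightarrow> nat \<Rightarrow> real" where
  "tau r d N =
     (if d = 1 then
        (real N - 1) * real_binomial ((real N - 2) / 2) ((real N - 1) / 2)
          * integral {0..arcsin r} (\<lambda>x. sin x ^ (N - 2))
      else
        real_binomial ((real N - 2) / 2) ((real N - real d) / 2)
          * r ^ (N - d) * (1 - r\<^sup>2) powr ((real d - 2) / 2))"

end

theory Submission
  imports Defs
begin

text \<open>
  Since \<open>f\<close> depends on \<open>x\<close> only through \<open>U\<^sup>T x\<close>, the \<open>k\<close>-th reduced problem has minimum at most
  \<open>f\<^sup>* + (\<epsilon> - \<lambda>)\<close> as soon as the column span of \<open>U\<^sup>T A\<^sup>k\<close> comes within \<open>(\<epsilon> - \<lambda>) / L\<close> of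
  \<open>U\<^sup>T (x\<^sup>* - p)\<close>. The columns of \<open>U\<^sup>T A\<^sup>k\<close> are independent standard Gaussian vectors. If there are
  \<open>d\<^sub>e\<close> of them they span the whole space almost surely. The first \<open>d\<^sub>l\<^sub>b\<close> of them span a random
  subspace; by rotation invariance the target direction can be averaged over a further Gaussian
  vector, which leaves the probability that a Gaussian vector makes a small angle with a fixed
  subspace, an incomplete beta integral of which \<open>\<tau>\<close> is a lower bound. Independence
  of \<open>A\<^sup>k\<close> from the past and conditioning on \<open>F\<^sup>k\<^sup>-\<^sup>1\<^sup>/\<^sup>2\<close> then shrink the probability that no iterate
  has succeeded by the factor \<open>1 - \<rho> \<tau>\<close> in every step.
\<close>

section \<open>Orthogonal invariance of Lebesgue measure and of the standard Gaussian\<close>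

text \<open>The difficulty lies in the order of the random choices within a step. The solver is
  controlled conditionally on \<open>half_past\<close>, which already contains \<open>A k\<close>,
  whereas the embedding has to be judged given the past only. The link is an event that belongs to
  \<open>half_past\<close> and whose probability given the past is bounded uniformly over all
  targets of norm at most \<open>Rmax\<close>, because the target depends on the past. It is phrased
  as a strict inequality about linear combinations of columns and not through the reduced minimum,
  an infimum over uncountably many points. The first \<open>dlb\<close> columns are present in every
  embedding, so they give the same constant in every step although the dimension grows. The origin
  of \<tau>: split a Gaussian vector into its parts along and across a subspace. Their norms are
  independent chi variables, and a small angle means that their ratio is below the tangent of the
  angle whose sine is r. Strictness at \<open>kmax\<close> comes from \<tau> > 0: with positive
  probability an earlier step has succeeded already.\<close>

text \<open>
  For translation-invariant \<open>\<mu>\<close> and \<open>\<nu>\<close>, Fubini applied to \<open>1\<^sub>A(x) 1\<^sub>B(y - x)\<close> gives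
  \<open>\<mu>(A) \<nu>(B) = \<nu>(A) \<mu>(B)\<close>; the unit ball \<open>B\<close> is orthogonally invariant.
\<close>

lemma lborel_distr_orthogonal_transformation:
  fixes T :: "'a::euclidean_space \<Rightarrow> 'a"
  assumes T: "orthogonal_transformation T"
  shows "distr lborel borel T = lborel"
proof (rule measure_eqI)
  let ?\<mu> = "distr lborel borel T"
  have lin: "linear T" using T by (rule orthogonal_transformation_linear)
  have T_meas [measurable]: "T \<in> borel_measurable borel"
    using lin by (intro borel_measurable_continuous_onI linear_continuous_on) (simp add: linear_conv_bounded_linear)
  have bij: "bij T" using T by (rule orthogonal_transformation_bij)
  \<comment> \<open>Balls around 0 are their own preimages, so they exhaust the space by sets of
    finite image measure.\<close>
  interpret \<mu>: sigma_finite_measure ?\<mu>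
  proof -
    obtain S where S: "orthogonal_transformation S" "\<And>x. S (T x) = x" "\<And>x. T (S x) = x"
      using orthogonal_transformation_inv[OF T] bij
      by (metis bij_inv_eq_iff)
    have S_meas [measurable]: "S \<in> borel_measurable borel"
      using orthogonal_transformation_linear[OF S(1)]
      by (intro borel_measurable_continuous_onI linear_continuous_on) (simp add: linear_conv_bounded_linear)
    have "emeasure ?\<mu> (ball 0 (real n)) \<noteq> \<infinity>" for n
    proof -
      have "T -` ball 0 (real n) = ball 0 (real n)"
        using T by (auto simp: orthogonal_transformation_norm)
      then show ?thesis
        using emeasure_bounded_finite[OF bounded_ball[of 0 "real n"], where 'a='a] by (simp add: emeasure_distr)
    qed
    moreover have "(\<Union>n. ball (0::'a) (real n)) = UNIV"
      by (auto simp: reals_Archimedean2)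
    ultimately show "sigma_finite_measure ?\<mu>"
      by (intro sigma_finite_measure.intro exI[of _ "range (\<lambda>n. ball 0 (real n))"]) auto
  qed
  interpret pair_sigma_finite ?\<mu> "lborel :: 'a measure" ..
  have transl: "emeasure lborel {x. x + c \<in> A} = emeasure lborel A" if [measurable]: "A \<in> sets borel" for A and c :: 'a
  proof -
    have "emeasure lborel A = emeasure (distr lborel borel ((+) c)) A"
      by (simp add: lborel_distr_plus)
    also have "\<dots> = emeasure lborel ((+) c -` A)"
      by (subst emeasure_distr) auto
    also have "(+) c -` A = {x. x + c \<in> A}" by (auto simp: add.commute)
    finally show ?thesis ..
  qed
  have transl_\<mu>: "emeasure ?\<mu> {x. x + c \<in> A} = emeasure ?\<mu> A" if [measurable]: "A \<in> sets borel" for A and c :: 'a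
  proof -
    \<comment> \<open>A translation by \<open>c\<close> after \<open>T\<close> is a translation by
      the preimage of \<open>c\<close> before \<open>T\<close>.\<close>
    obtain c' where c': "c = T c'" using bij by (metis bij_pointE)
    have "emeasure ?\<mu> {x. x + c \<in> A} = emeasure lborel {x. x + c' \<in> T -` A}"
      by (subst emeasure_distr) (auto simp: c' linear_add[OF lin])
    also have "\<dots> = emeasure lborel (T -` A)"
      using measurable_sets[OF T_meas that] by (intro transl) simp
    finally show ?thesis by (subst emeasure_distr) auto
  qed
  let ?B = "ball (0::'a) 1"
  have [measurable]: "Measurable.pred (borel \<Otimes>\<^sub>M borel) (\<lambda>x. snd x - fst x \<in> ?B)"
    unfolding mem_ball dist_norm by measurable
  have [measurable]: "Measurable.pred (borel \<Otimes>\<^sub>M borel) (\<lambda>x::'a \<times> 'a. fst x \<in> ?B)"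
    unfolding mem_ball dist_norm by measurable
  have \<mu>B: "emeasure ?\<mu> ?B = emeasure lborel ?B"
  proof -
    have T_B: "T -` ?B = ?B" using T by (auto simp: orthogonal_transformation_norm)
    have "emeasure ?\<mu> ?B = emeasure lborel (T -` ?B)" by (subst emeasure_distr) auto
    then show ?thesis unfolding T_B .
  qed
  fix A assume "A \<in> sets ?\<mu>"
  then have A [measurable]: "A \<in> sets borel" by simp
  have "emeasure ?\<mu> A * emeasure lborel ?B
      = (\<integral>\<^sup>+x. indicator A x * emeasure lborel ?B \<partial>?\<mu>)"
    by (simp add: nn_integral_multc)
  also have "\<dots> = (\<integral>\<^sup>+x. \<integral>\<^sup>+y. indicator A x * indicator ?B (y - x) \<partial>lborel \<partial>?\<mu>)"
  proof (rule nn_integral_cong)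
    fix x :: 'a
    have "(\<integral>\<^sup>+y. indicator A x * indicator ?B (y - x) \<partial>lborel) = indicator A x * (\<integral>\<^sup>+y. indicator {y. y + (-x) \<in> ?B} y \<partial>lborel)"
      by (subst nn_integral_cmult[symmetric]) (auto intro!: nn_integral_cong simp: indicator_def)
    also have "(\<integral>\<^sup>+y. indicator {y. y + (-x) \<in> ?B} y \<partial>lborel) = emeasure lborel {y. y + (-x) \<in> ?B}"
      by (intro nn_integral_indicator) simp
    also have "\<dots> = emeasure lborel ?B" by (rule transl) simp
    finally show "indicator A x * emeasure lborel ?B = (\<integral>\<^sup>+y. indicator A x * indicator ?B (y - x) \<partial>lborel)" ..
  qed
  also have "\<dots> = (\<integral>\<^sup>+y. \<integral>\<^sup>+x. indicator A x * indicator ?B (y - x) \<partial>?\<mu> \<partial>lborel)"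
    by (rule Fubini'[symmetric]) measurable
  \<comment> \<open>Replacing x by x + y leaves 1_B(-x) as second factor, and the ball is
    symmetric.\<close>
  also have "\<dots> = (\<integral>\<^sup>+y. \<integral>\<^sup>+x. indicator A (x + y) * indicator ?B x \<partial>?\<mu> \<partial>lborel)"
  proof (rule nn_integral_cong)
    fix y :: 'a
    define C where "C = A \<inter> {x. y - x \<in> ?B}"
    have C[measurable]: "C \<in> sets borel" unfolding C_def mem_ball dist_norm by measurable
    have "(\<integral>\<^sup>+x. indicator A x * indicator ?B (y - x) \<partial>?\<mu>) = (\<integral>\<^sup>+x. indicator C x \<partial>?\<mu>)"
      by (intro nn_integral_cong) (auto simp: C_def indicator_def)
    also have "\<dots> = emeasure ?\<mu> C" by (intro nn_integral_indicator) simp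
    also have "\<dots> = emeasure ?\<mu> {x. x + y \<in> C}" by (rule transl_\<mu>[symmetric]) simp
    also have "\<dots> = (\<integral>\<^sup>+x. indicator {x. x + y \<in> C} x \<partial>?\<mu>)" by (intro nn_integral_indicator[symmetric]) simp
    also have "\<dots> = (\<integral>\<^sup>+x. indicator A (x + y) * indicator ?B x \<partial>?\<mu>)"
      by (intro nn_integral_cong) (auto simp: C_def indicator_def)
    finally show "(\<integral>\<^sup>+x. indicator A x * indicator ?B (y - x) \<partial>?\<mu>) = (\<integral>\<^sup>+x. indicator A (x + y) * indicator ?B x \<partial>?\<mu>)" .
  qed
  also have "\<dots> = (\<integral>\<^sup>+x. \<integral>\<^sup>+y. indicator A (x + y) * indicator ?B x \<partial>lborel \<partial>?\<mu>)"
    by (rule Fubini') measurable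
  also have "\<dots> = (\<integral>\<^sup>+x. emeasure lborel A * indicator ?B x \<partial>?\<mu>)"
  proof (rule nn_integral_cong)
    fix x :: 'a
    have "(\<integral>\<^sup>+y. indicator A (x + y) * indicator ?B x \<partial>lborel) = (\<integral>\<^sup>+y. indicator {y. y + x \<in> A} y \<partial>lborel) * indicator ?B x"
      by (subst nn_integral_multc[symmetric]) (auto intro!: nn_integral_cong simp: indicator_def add.commute)
    also have "(\<integral>\<^sup>+y. indicator {y. y + x \<in> A} y \<partial>lborel) = emeasure lborel {y. y + x \<in> A}"
      by (intro nn_integral_indicator) simp
    also have "\<dots> = emeasure lborel A" by (rule transl) simp
    finally show "(\<integral>\<^sup>+y. indicator A (x + y) * indicator ?B x \<partial>lborel) = emeasure lborel A * indicator ?B x" .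
  qed
  also have "\<dots> = emeasure lborel A * emeasure ?\<mu> ?B"
    by (rule nn_integral_cmult_indicator) simp
  finally have "emeasure ?\<mu> A * emeasure lborel ?B = emeasure lborel A * emeasure lborel ?B"
    by (simp add: \<mu>B)
  moreover have "unit_ball_vol (real DIM('a)) \<noteq> 0"
    by (metis unit_ball_vol_pos of_nat_0_le_iff less_irrefl)
  then have "emeasure lborel ?B \<noteq> 0" "emeasure lborel ?B \<noteq> \<infinity>"
    by (simp_all add: emeasure_ball)
  ultimately show "emeasure ?\<mu> A = emeasure lborel A"
    by (simp add: mult.commute[of _ "emeasure lborel ?B"] ennreal_mult_cancel_left)
qed simp

section \<open>The standard Gaussian measure on a Euclidean space\<close>

abbreviation std_normal :: "real measure" where
  "std_normal \<equiv> density lborel (\<lambda>x. ennreal (std_normal_density x))"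

lemma prob_space_std_normal: "prob_space std_normal"
  by (rule prob_space_normal_density) simp

interpretation std_normal: prob_space std_normal
  by (rule prob_space_std_normal)

text \<open>The one-dimensional densities multiply to a function of the sum of squares alone.
  Rotation invariance and the law of the norm both rest on this form.\<close>

lemma PiM_std_normal:
  assumes I: "finite I"
  shows "PiM I (\<lambda>_. std_normal) =
    density (PiM I (\<lambda>_. lborel)) (\<lambda>x. ennreal (exp (- (\<Sum>i\<in>I. (x i)\<^sup>2) / 2) / sqrt (2 * pi) ^ card I))"
proof -
  interpret P: product_sigma_finite "\<lambda>_::'a. std_normal"
    by (intro product_sigma_finite.intro) (rule std_normal.sigma_finite_measure_axioms)
  interpret L: product_sigma_finite "\<lambda>_::'a. lborel :: real measure"
    by (intro product_sigma_finite.intro) (rule sigma_finite_lborel)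
  have dens: "ennreal (exp (- (\<Sum>i\<in>I. (x i)\<^sup>2) / 2) / sqrt (2 * pi) ^ card I) =
      (\<Prod>i\<in>I. ennreal (std_normal_density (x i)))" for x :: "'a \<Rightarrow> real"
  proof -
    have "(\<Prod>i\<in>I. ennreal (std_normal_density (x i))) = ennreal (\<Prod>i\<in>I. std_normal_density (x i))"
      by (rule prod_ennreal) simp
    also have "(\<Prod>i\<in>I. std_normal_density (x i)) = exp (\<Sum>i\<in>I. - (x i)\<^sup>2 / 2) / sqrt (2 * pi) ^ card I"
      by (simp add: std_normal_density_def prod.distrib exp_sum[OF I] power_one_over prod_dividef)
    also have "(\<Sum>i\<in>I. - (x i)\<^sup>2 / 2) = - (\<Sum>i\<in>I. (x i)\<^sup>2) / 2"
      by (simp add: sum_negf sum_divide_distrib)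
    finally show ?thesis ..
  qed
  show ?thesis unfolding dens
  proof (rule P.PiM_eqI[symmetric])
    fix A assume A: "\<And>i. i \<in> I \<Longrightarrow> A i \<in> sets std_normal"
    have "emeasure (density (PiM I (\<lambda>_. lborel)) (\<lambda>x. \<Prod>i\<in>I. ennreal (std_normal_density (x i)))) (Pi\<^sub>E I A)
        = (\<integral>\<^sup>+x. (\<Prod>i\<in>I. ennreal (std_normal_density (x i))) * indicator (Pi\<^sub>E I A) x \<partial>PiM I (\<lambda>_. lborel))"
      using A I by (intro emeasure_density) (auto intro!: sets_PiM_I_finite borel_measurable_prod)
    also have "\<dots> = (\<integral>\<^sup>+x. (\<Prod>i\<in>I. ennreal (std_normal_density (x i)) * indicator (A i) (x i)) \<partial>PiM I (\<lambda>_. lborel))"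
    proof (rule nn_integral_cong)
      fix x assume "x \<in> space (PiM I (\<lambda>_. lborel :: real measure))"
      then have "indicator (Pi\<^sub>E I A) x = (\<Prod>i\<in>I. indicator (A i) (x i) :: ennreal)"
        using I by (auto simp: indicator_def space_PiM PiE_iff prod_zero_iff)
      then show "(\<Prod>i\<in>I. ennreal (std_normal_density (x i))) * indicator (Pi\<^sub>E I A) x =
          (\<Prod>i\<in>I. ennreal (std_normal_density (x i)) * indicator (A i) (x i))"
        by (simp add: prod.distrib)
    qed
    also have "\<dots> = (\<Prod>i\<in>I. \<integral>\<^sup>+x. ennreal (std_normal_density x) * indicator (A i) x \<partial>lborel)"
      using A I by (intro L.product_nn_integral_prod) auto
    also have "\<dots> = (\<Prod>i\<in>I. emeasure std_normal (A i))"
      using A by (intro prod.cong refl emeasure_density[symmetric]) auto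
    finally show "emeasure (density (PiM I (\<lambda>_. lborel)) (\<lambda>x. \<Prod>i\<in>I. ennreal (std_normal_density (x i)))) (Pi\<^sub>E I A)
        = (\<Prod>i\<in>I. emeasure std_normal (A i))" .
  qed (use I in \<open>auto intro!: sets_PiM_cong\<close>)
qed

text \<open>Given by its density, so that rotation invariance reduces to that of Lebesgue measure.
  Independence of the coordinates is recovered in \<open>gauss_eq_distr_PiM\<close>.\<close>

definition gauss :: "'a::euclidean_space measure" where
  "gauss = density lborel (\<lambda>x. ennreal (exp (- (norm x)\<^sup>2 / 2) / sqrt (2 * pi) ^ DIM('a)))"

lemma sets_gauss [simp, measurable_cong]: "sets gauss = sets borel"
  by (simp add: gauss_def)

lemma space_gauss [simp]: "space gauss = UNIV"
  by (simp add: gauss_def)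

lemma gauss_eq_distr_PiM:
  "(gauss :: 'a::euclidean_space measure) =
    distr (PiM Basis (\<lambda>_. std_normal)) borel (\<lambda>f. \<Sum>b\<in>Basis. f b *\<^sub>R b)"
proof -
  let ?h = "\<lambda>x::'a. ennreal (exp (- (norm x)\<^sup>2 / 2) / sqrt (2 * pi) ^ DIM('a))"
  have norm: "(norm (\<Sum>b\<in>Basis. f b *\<^sub>R b :: 'a))\<^sup>2 = (\<Sum>b\<in>(Basis::'a set). (f b)\<^sup>2)" for f
  proof -
    have "(norm (\<Sum>b\<in>Basis. f b *\<^sub>R b :: 'a))\<^sup>2 = (\<Sum>b\<in>Basis. ((\<Sum>b\<in>Basis. f b *\<^sub>R b :: 'a) \<bullet> b)\<^sup>2)"
      by (subst power2_norm_eq_inner, subst euclidean_inner) (simp add: power2_eq_square)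
    then show ?thesis by (simp add: inner_sum_left_Basis)
  qed
  have "(gauss :: 'a measure) = density (distr (PiM Basis (\<lambda>_. lborel)) borel (\<lambda>f. \<Sum>b\<in>Basis. f b *\<^sub>R b)) ?h"
    unfolding gauss_def by (subst lborel_eq) (rule refl)
  also have "\<dots> = distr (density (PiM Basis (\<lambda>_. lborel)) (\<lambda>f. ?h (\<Sum>b\<in>Basis. f b *\<^sub>R b))) borel (\<lambda>f. \<Sum>b\<in>Basis. f b *\<^sub>R b)"
    by (rule density_distr) measurable
  also have "density (PiM Basis (\<lambda>_. lborel)) (\<lambda>f. ?h (\<Sum>b\<in>Basis. f b *\<^sub>R b)) = PiM (Basis::'a set) (\<lambda>_. std_normal)"
    by (simp add: PiM_std_normal norm)
  finally show ?thesis .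
qed

lemma prob_space_PiM_std_normal: "prob_space (PiM I (\<lambda>_. std_normal))"
  by (intro prob_space_PiM prob_space_std_normal)

lemma prob_space_gauss: "prob_space (gauss :: 'a::euclidean_space measure)"
  unfolding gauss_eq_distr_PiM
  by (intro prob_space.prob_space_distr prob_space_PiM_std_normal) simp

interpretation gauss: prob_space "gauss :: 'a::euclidean_space measure"
  by (rule prob_space_gauss)

lemma borel_measurable_linear:
  fixes f :: "'a::euclidean_space \<Rightarrow> 'b::real_normed_vector"
  shows "linear f \<Longrightarrow> f \<in> borel_measurable borel"
  by (intro borel_measurable_continuous_onI linear_continuous_on) (simp add: linear_conv_bounded_linear)

lemma distr_gauss_orthogonal_transformation:
  fixes T :: "'a::euclidean_space \<Rightarrow> 'a"
  assumes T: "orthogonal_transformation T"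
  shows "distr gauss borel T = gauss"
proof -
  let ?h = "\<lambda>x::'a. ennreal (exp (- (norm x)\<^sup>2 / 2) / sqrt (2 * pi) ^ DIM('a))"
  have [measurable]: "T \<in> borel_measurable borel"
    using T by (intro borel_measurable_linear orthogonal_transformation_linear)
  have "(gauss :: 'a measure) = density (distr lborel borel T) ?h"
    by (simp add: gauss_def lborel_distr_orthogonal_transformation[OF T])
  also have "\<dots> = distr (density lborel (\<lambda>x. ?h (T x))) borel T"
    by (rule density_distr) measurable
  also have "density lborel (\<lambda>x. ?h (T x)) = gauss"
    by (simp add: gauss_def orthogonal_transformation_norm[OF T])
  finally show ?thesis ..
qed

section \<open>Coordinates of a Gaussian vector in an orthonormal family\<close>

text \<open>The family is completed to an orthonormal basis \<open>B\<close>, and any bijection from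
  \<open>Basis\<close> to \<open>B\<close> extends linearly to an orthogonal transformation. The map
  \<open>e\<close> records which standard basis vector goes to which member of the family.\<close>

lemma orthonormal_family_eq_image_Basis:
  fixes s :: "'i \<Rightarrow> 'a::euclidean_space"
  assumes J: "finite J" and s: "\<And>i j. i \<in> J \<Longrightarrow> j \<in> J \<Longrightarrow> s i \<bullet> s j = of_bool (i = j)"
  obtains T :: "'a \<Rightarrow> 'a" and e where "orthogonal_transformation T" "inj_on e J" "e ` J \<subseteq> Basis" "\<And>j. j \<in> J \<Longrightarrow> T (e j) = s j"
proof -
  have inj_s: "inj_on s J"
    by (rule inj_onI) (metis (full_types) s of_bool_eq_1_iff)
  have orth: "pairwise orthogonal (s ` J)"
    by (auto simp: pairwise_def orthogonal_def s)
  obtain U where U: "U \<inter> insert 0 (s ` J) = {}" "pairwise orthogonal (s ` J \<union> U)"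
      "span (s ` J \<union> U) = span (s ` J \<union> UNIV)"
    using orthogonal_extension_strong[OF orth] .
  \<comment> \<open>Only the added vectors are normalised, since those of the family are unit
    vectors already; \<open>U\<close> does not contain 0.\<close>
  define B where "B = s ` J \<union> (\<lambda>x. x /\<^sub>R norm x) ` U"
  have s0: "s j \<noteq> 0" if "j \<in> J" for j using s[OF that that] by auto
  have norm1: "norm x = 1" if "x \<in> B" for x
    using that unfolding B_def
  proof
    assume "x \<in> (\<lambda>x. x /\<^sub>R norm x) ` U"
    then obtain x' where "x' \<in> U" "x = x' /\<^sub>R norm x'" by auto
    then show ?thesis using U(1) by (cases "x' = 0") auto
  qed (use s in \<open>auto simp: norm_eq_1\<close>)
  have orthB: "pairwise orthogonal B"
    unfolding pairwise_def
  proof (intro ballI impI)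
    define n where "n x = x /\<^sub>R norm x" for x :: 'a
    have B: "B = n ` (s ` J \<union> U)"
      unfolding B_def n_def image_Un by (auto simp: image_image s norm_eq_1[symmetric] norm_eq_sqrt_inner intro!: image_cong)
    fix x y assume "x \<in> B" "y \<in> B" "x \<noteq> y"
    then obtain x' where x': "x' \<in> s ` J \<union> U" "x = n x'" unfolding B by blast
    from \<open>y \<in> B\<close> obtain y' where y': "y' \<in> s ` J \<union> U" "y = n y'" unfolding B by blast
    from x' y' \<open>x \<noteq> y\<close> have "x' \<noteq> y'" by auto
    with U(2) x'(1) y'(1) have "orthogonal x' y'" unfolding pairwise_def by blast
    then show "orthogonal x y" by (simp add: x'(2) y'(2) n_def orthogonal_def)
  qed
  have indepB: "independent B"
    using orthB norm1[of 0] by (intro pairwise_orthogonal_independent) auto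
  have "U \<subseteq> span B"
  proof
    fix x assume x: "x \<in> U"
    then have "x = norm x *\<^sub>R (x /\<^sub>R norm x)" using U(1) by (cases "x = 0") auto
    also have "\<dots> \<in> span B" using x by (intro span_mul span_base) (auto simp: B_def)
    finally show "x \<in> span B" .
  qed
  then have "span (s ` J \<union> U) \<subseteq> span B"
    by (intro span_minimal) (auto simp: B_def intro: span_base)
  then have spanB: "span B = UNIV" using U(3) by auto
  have cardB: "card B = DIM('a)"
    using indepB spanB by (metis dim_UNIV dim_eq_card dim_span)
  have finB: "finite B" using indepB by (rule independent_imp_finite)
  have inner_B: "x \<bullet> y = of_bool (x = y)" if "x \<in> B" "y \<in> B" for x y
    using orthB norm1 that by (auto simp: pairwise_def orthogonal_def norm_eq_1)
  obtain g where g: "bij_betw g (Basis::'a set) B"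
    using finB cardB finite_same_card_bij[of "Basis::'a set" B] by auto
  define T where "T x = (\<Sum>b\<in>Basis. (x \<bullet> b) *\<^sub>R g b)" for x :: 'a
  have gB: "g b \<in> B" if "b \<in> Basis" for b using g that by (auto simp: bij_betw_def)
  have inner_g: "g b \<bullet> g c = of_bool (b = c)" if "b \<in> Basis" "c \<in> Basis" for b c
    using inner_B[OF gB gB] that g by (auto simp: bij_betw_def inj_on_def)
  have Tb: "T b = g b" if "b \<in> Basis" for b
    unfolding T_def using that by (simp add: inner_Basis if_distrib[of "\<lambda>x. x *\<^sub>R _"] sum.delta cong: if_cong)
  have "orthogonal_transformation T"
    unfolding orthogonal_transformation_def
  proof (intro conjI allI)
    show "linear T"
      by (rule linearI) (simp_all add: T_def inner_add_left scaleR_add_left sum.distrib scaleR_sum_right)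
    fix v w :: 'a
    have "T v \<bullet> T w = (\<Sum>b\<in>Basis. (w \<bullet> b) * (\<Sum>c\<in>Basis. (v \<bullet> c) * (g c \<bullet> g b)))"
      by (simp add: T_def inner_sum_left inner_sum_right)
    also have "\<dots> = (\<Sum>b\<in>Basis. (v \<bullet> b) * (w \<bullet> b))"
      by (intro sum.cong refl) (simp add: inner_g of_bool_def if_distrib mult.commute cong: if_cong)
    also have "\<dots> = v \<bullet> w" by (rule euclidean_inner[symmetric])
    finally show "T v \<bullet> T w = v \<bullet> w" .
  qed
  moreover define e where "e = inv_into Basis g \<circ> s"
  have sB: "s ` J \<subseteq> B" by (auto simp: B_def)
  then have "inj_on e J"
    unfolding e_def using g inj_s
    by (intro comp_inj_on) (auto simp: bij_betw_def intro: inj_on_subset inj_on_inv_into)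
  moreover have "e ` J \<subseteq> Basis"
    using sB g by (auto simp: e_def bij_betw_def intro!: inv_into_into)
  moreover have "T (e j) = s j" if "j \<in> J" for j
  proof -
    have "e j \<in> Basis" using that \<open>e ` J \<subseteq> Basis\<close> by auto
    then have "T (e j) = g (e j)" by (rule Tb)
    also have "\<dots> = s j" using sB g that by (auto simp: e_def bij_betw_def f_inv_into_f subset_iff)
    finally show ?thesis .
  qed
  ultimately show thesis by (rule that)
qed

text \<open>An orthogonal transformation carries distinct standard basis vectors to the
  \<open>s j\<close>, and coordinates with respect to standard basis vectors are independent by the
  product form of \<open>gauss\<close>.\<close>

lemma distr_gauss_orthonormal_coordinates:
  fixes s :: "'i \<Rightarrow> 'a::euclidean_space"
  assumes J: "finite J" and s: "\<And>i j. i \<in> J \<Longrightarrow> j \<in> J \<Longrightarrow> s i \<bullet> s j = of_bool (i = j)"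
  shows "distr gauss (PiM J (\<lambda>_. borel)) (\<lambda>x. \<lambda>j\<in>J. x \<bullet> s j) = PiM J (\<lambda>_. std_normal)"
proof -
  obtain T :: "'a \<Rightarrow> 'a" and e where T: "orthogonal_transformation T" and e: "inj_on e J" "e ` J \<subseteq> Basis"
    and Te: "\<And>j. j \<in> J \<Longrightarrow> T (e j) = s j"
    using orthonormal_family_eq_image_Basis[OF J s] by blast
  have [measurable]: "T \<in> borel_measurable borel"
    using T by (intro borel_measurable_linear orthogonal_transformation_linear)
  have "distr gauss (PiM J (\<lambda>_. borel)) (\<lambda>x. \<lambda>j\<in>J. x \<bullet> s j) =
      distr (distr gauss borel T) (PiM J (\<lambda>_. borel)) (\<lambda>x. \<lambda>j\<in>J. x \<bullet> s j)"
    by (simp add: distr_gauss_orthogonal_transformation[OF T])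
  also have "\<dots> = distr gauss (PiM J (\<lambda>_. borel)) (\<lambda>x. \<lambda>j\<in>J. T x \<bullet> s j)"
    by (subst distr_distr) (simp_all add: comp_def)
  also have "\<dots> = distr gauss (PiM J (\<lambda>_. borel)) (\<lambda>x. \<lambda>j\<in>J. x \<bullet> e j)"
    using T by (intro distr_cong refl) (auto simp: Te[symmetric] orthogonal_transformation_def fun_eq_iff)
  also have "\<dots> = distr (PiM Basis (\<lambda>_. std_normal)) (PiM J (\<lambda>_. borel)) (\<lambda>f. \<lambda>j\<in>J. (\<Sum>b\<in>Basis. f b *\<^sub>R b) \<bullet> e j)"
    unfolding gauss_eq_distr_PiM by (subst distr_distr) (simp_all add: comp_def)
  also have "\<dots> = distr (PiM Basis (\<lambda>_. std_normal)) (PiM J (\<lambda>_. std_normal)) (\<lambda>f. \<lambda>j\<in>J. f (e j))"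
    using e by (intro distr_cong refl sets_PiM_cong) (auto simp: fun_eq_iff inner_sum_left_Basis)
  also have "\<dots> = PiM J (\<lambda>_. std_normal)"
    using e by (intro distr_PiM_reindex prob_space_std_normal) auto
  finally show ?thesis .
qed

text \<open>The coordinates of \<open>u x\<close> are inner products of \<open>x\<close> with the
  vectors \<open>v b\<close>, which are orthonormal because \<open>v\<close> is an isometry. Later
  \<open>u\<close> is multiplication by the transpose of \<open>U\<close>, and \<open>v\<close>
  multiplication by \<open>U\<close>.\<close>

lemma distr_gauss_isometry_adjoint:
  fixes u :: "'a::euclidean_space \<Rightarrow> 'b::euclidean_space"
  assumes u: "linear u" and v: "\<And>x z. u x \<bullet> z = x \<bullet> v z" and iso: "\<And>z w. v z \<bullet> v w = z \<bullet> w"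
  shows "distr gauss borel u = gauss"
proof -
  have [measurable]: "u \<in> borel_measurable borel"
    using u by (rule borel_measurable_linear)
  have "(gauss :: 'b measure) = distr (PiM Basis (\<lambda>_. std_normal)) borel (\<lambda>f. \<Sum>b\<in>Basis. f b *\<^sub>R b)"
    by (rule gauss_eq_distr_PiM)
  also have "PiM (Basis :: 'b set) (\<lambda>_. std_normal) = distr (gauss :: 'a measure) (PiM Basis (\<lambda>_. borel)) (\<lambda>x. \<lambda>b\<in>Basis. x \<bullet> v b)"
    by (rule distr_gauss_orthonormal_coordinates[symmetric]) (auto simp: iso inner_Basis)
  also have "distr \<dots> borel (\<lambda>f. \<Sum>b\<in>Basis. f b *\<^sub>R b) = distr (gauss :: 'a measure) borel (\<lambda>x. \<Sum>b\<in>Basis. (x \<bullet> v b) *\<^sub>R b)"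
    by (subst distr_distr) (auto simp: comp_def)
  also have "(\<lambda>x. \<Sum>b\<in>Basis. (x \<bullet> v b) *\<^sub>R b) = u"
    by (simp add: v[symmetric] euclidean_representation)
  finally show ?thesis ..
qed

lemma borel_measurable_vec_lambda [measurable (raw)]:
  fixes f :: "'w \<Rightarrow> 'n::finite \<Rightarrow> real"
  assumes "\<And>i. (\<lambda>x. f x i) \<in> borel_measurable M"
  shows "(\<lambda>x. \<chi> i. f x i) \<in> borel_measurable M"
  using assms by (subst borel_measurable_euclidean_space) (auto simp: Basis_vec_def inner_axis)

lemma gauss_eq_distr_cart:
  "(gauss :: (real^'n) measure) = distr (PiM UNIV (\<lambda>_. std_normal)) borel (\<lambda>f. \<chi> i. f i)"
proof -
  have "PiM (UNIV :: 'n set) (\<lambda>_. std_normal) = distr (gauss :: (real^'n) measure) (PiM UNIV (\<lambda>_. borel)) (\<lambda>x. \<lambda>i\<in>UNIV. x \<bullet> axis i 1)"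
    by (rule distr_gauss_orthonormal_coordinates[symmetric]) (auto simp: inner_axis_axis)
  also have "distr \<dots> borel (\<lambda>f. \<chi> i. f i) = distr gauss borel (\<lambda>x. x)"
    by (subst distr_distr) (auto simp: comp_def inner_axis vec_eq_iff intro!: distr_cong)
  also have "\<dots> = gauss" by (rule distr_id2) simp
  finally show ?thesis ..
qed

lemma gauss_subspace_null:
  fixes S :: "'a::euclidean_space set"
  assumes S: "subspace S" "dim S < DIM('a)"
  shows "S \<in> null_sets gauss"
proof -
  have "closed S" using S(1) by (rule closed_subspace)
  moreover from S(2) have "negligible S" by (rule negligible_lowdim)
  ultimately have "S \<in> null_sets lborel"
    by (simp add: negligible_iff_null_sets null_sets_completion_iff)
  then show ?thesis
    unfolding gauss_def by (auto simp: null_sets_density_iff dest: AE_not_in)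
qed

section \<open>The angle between a Gaussian vector and a fixed subspace\<close>

text \<open>The density of the chi distribution with \<open>m\<close> degrees of freedom;
  \<open>m\<close> times the ball volume is the area of the unit sphere.\<close>

definition chi_density :: "nat \<Rightarrow> real \<Rightarrow> real" where
  "chi_density m u = indicator {0..} u *
     (real m * unit_ball_vol (real m) / sqrt (2 * pi) ^ m) * u ^ (m - 1) * exp (- u\<^sup>2 / 2)"

lemma chi_density_nonneg [simp]: "0 \<le> chi_density m u"
  by (simp add: chi_density_def indicator_def)

lemma borel_measurable_chi_density [measurable]: "chi_density m \<in> borel_measurable borel"
  unfolding chi_density_def by measurable

text \<open>The volume of a ball is a constant times the power \<open>a ^ m\<close> of its radius,
  and the density is the derivative in \<open>a\<close>. Both measures are compared on half-lines,
  an intersection-stable generator.\<close>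

lemma distr_PiM_lborel_norm:
  assumes I: "finite I" "I \<noteq> {}"
  shows "distr (PiM I (\<lambda>_. lborel)) borel (\<lambda>x. sqrt (\<Sum>i\<in>I. (x i)\<^sup>2)) =
    density lborel (\<lambda>u. ennreal (indicator {0..} u * (real (card I) * unit_ball_vol (real (card I)) * u ^ (card I - 1))))"
    (is "?L = ?R")
proof (rule measure_eqI_generator_eq[where E = "range atMost" and A = "\<lambda>n. {..real n}" and \<Omega> = UNIV])
  define m where "m = card I"
  have m: "m > 0" using I by (auto simp: m_def card_gt_0_iff)
  show "Int_stable (range (atMost :: real \<Rightarrow> _))"
    by (auto simp: Int_stable_def)
  have L: "emeasure ?L {..a} = ennreal (unit_ball_vol (real m) * a ^ m)" if "a > 0" for a
  proof -
    have "emeasure ?L {..a} = emeasure (PiM I (\<lambda>_. lborel)) ({x. sqrt (\<Sum>i\<in>I. (x i)\<^sup>2) \<le> a} \<inter> space (PiM I (\<lambda>_. lborel)))"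
      by (subst emeasure_distr) (auto simp: vimage_def)
    then show ?thesis using emeasure_cball_aux[OF I(1) that] by (simp add: m_def)
  qed
  have R: "emeasure ?R {..a} = ennreal (unit_ball_vol (real m) * a ^ m)" if "a \<ge> 0" for a
  proof -
    have "emeasure ?R {..a} = (\<integral>\<^sup>+u. ennreal (real m * unit_ball_vol (real m) * u ^ (m - 1)) * indicator {0..a} u \<partial>lborel)"
      by (subst emeasure_density) (auto intro!: nn_integral_cong simp: m_def indicator_def)
    also have "\<dots> = unit_ball_vol (real m) * a ^ m - unit_ball_vol (real m) * 0 ^ m"
      using that m
      by (intro nn_integral_FTC_Icc)
        (auto intro!: derivative_eq_intros simp: has_real_derivative_iff_has_vector_derivative[symmetric])
    finally show ?thesis using m by (simp add: power_0_left)
  qed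
  fix X assume "X \<in> range (atMost :: real \<Rightarrow> _)"
  then obtain a where X: "X = {..a}" by auto
  \<comment> \<open>The volume formula is available for positive radii; the radius 0 is reached as a
    limit from the right.\<close>
  have L0: "emeasure ?L {..0} = 0"
  proof -
    have "emeasure ?L {..0} \<le> ennreal (unit_ball_vol (real m) * a ^ m)" if "a > 0" for a
      unfolding L[OF that, symmetric] using that by (intro emeasure_mono) auto
    moreover have "((\<lambda>a. ennreal (unit_ball_vol (real m) * a ^ m)) \<longlongrightarrow> ennreal (unit_ball_vol (real m) * 0 ^ m)) (at_right 0)"
      by (intro tendsto_intros)
    ultimately have "emeasure ?L {..0} \<le> ennreal (unit_ball_vol (real m) * 0 ^ m)"
      by (intro tendsto_lowerbound[of _ _ "at_right (0::real)"]) (auto simp: eventually_at_right_less intro!: eventually_at_right_less[THEN eventually_mono])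
    then show ?thesis using m by (simp add: power_0_left)
  qed
  show "emeasure ?L X = emeasure ?R X"
  proof (cases "a > 0")
    case True
    then show ?thesis unfolding X using L R by simp
  next
    case False
    have "emeasure ?L {..a} \<le> emeasure ?L {..0}" "emeasure ?R {..a} \<le> emeasure ?R {..0}"
      using False by (intro emeasure_mono; simp)+
    then show ?thesis unfolding X using L0 R[of 0] m by (simp add: power_0_left)
  qed
next
  show "sets ?L = sigma_sets UNIV (range atMost)" "sets ?R = sigma_sets UNIV (range atMost)"
    by (simp_all add: borel_eq_atMost)
  show "(\<Union>i::nat. {..real i}) = UNIV" by (auto simp: real_arch_simple)
  show "emeasure ?L {..real n} \<noteq> \<infinity>" for n
  proof -
    have "emeasure ?L {..real n} \<le> emeasure ?L {..real (Suc n)}" by (intro emeasure_mono) auto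
    also have "\<dots> = emeasure (PiM I (\<lambda>_. lborel)) ({x. sqrt (\<Sum>i\<in>I. (x i)\<^sup>2) \<le> real (Suc n)} \<inter> space (PiM I (\<lambda>_. lborel)))"
      by (subst emeasure_distr) (auto simp: vimage_def)
    also have "\<dots> < \<infinity>" by (subst emeasure_cball_aux[OF I(1)]) auto
    finally show ?thesis by simp
  qed
qed auto

text \<open>The Gaussian density is a function of the norm, hence can be pulled through the image
  measure.\<close>

lemma distr_PiM_std_normal_norm:
  assumes I: "finite I" "I \<noteq> {}"
  shows "distr (PiM I (\<lambda>_. std_normal)) borel (\<lambda>x. sqrt (\<Sum>i\<in>I. (x i)\<^sup>2)) =
    density lborel (\<lambda>u. ennreal (chi_density (card I) u))"
proof -
  let ?n = "\<lambda>x. sqrt (\<Sum>i\<in>I. (x i)\<^sup>2)" and ?h = "\<lambda>u. ennreal (exp (- u\<^sup>2 / 2) / sqrt (2 * pi) ^ card I)"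
  have "PiM I (\<lambda>_. std_normal) = density (PiM I (\<lambda>_. lborel)) (\<lambda>x. ?h (?n x))"
    by (simp add: PiM_std_normal[OF I(1)] sum_nonneg)
  then have "distr (PiM I (\<lambda>_. std_normal)) borel ?n = distr (density (PiM I (\<lambda>_. lborel)) (\<lambda>x. ?h (?n x))) borel ?n"
    by simp
  also have "\<dots> = density (distr (PiM I (\<lambda>_. lborel)) borel ?n) ?h"
    by (rule density_distr[symmetric]) measurable
  also have "\<dots> = density lborel (\<lambda>u. ennreal (chi_density (card I) u))"
    unfolding distr_PiM_lborel_norm[OF I]
    by (subst density_density_eq)
      (auto intro!: density_cong simp: chi_density_def ennreal_mult'[symmetric] indicator_def field_simps)
  finally show ?thesis .
qed

text \<open>The total mass is 1 because this is the density of the law of a random variable.\<close>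

lemma nn_integral_chi_density:
  assumes "m > 0"
  shows "(\<integral>\<^sup>+u. ennreal (chi_density m u) \<partial>lborel) = 1"
proof -
  have "prob_space (density lborel (\<lambda>u. ennreal (chi_density m u)))"
  proof -
    have "density lborel (\<lambda>u. ennreal (chi_density m u)) =
        distr (PiM {..<m} (\<lambda>_. std_normal)) borel (\<lambda>x. sqrt (\<Sum>i<m. (x i)\<^sup>2))"
      using assms by (subst distr_PiM_std_normal_norm) (auto simp: lessThan_empty_iff bot_nat_def)
    then show ?thesis
      by (simp only:) (intro prob_space.prob_space_distr prob_space_PiM_std_normal, measurable)
  qed
  from prob_space.emeasure_space_1[OF this] show ?thesis
    by (simp add: emeasure_density)
qed

text \<open>The two blocks of coordinates are independent and enter only through their norms, so a
  double integral over two chi densities remains.\<close>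

lemma emeasure_PiM_std_normal_cone:
  assumes I: "finite I" "I \<noteq> {}" and J: "finite J" "J \<noteq> {}" and disj: "I \<inter> J = {}"
  shows "emeasure (PiM (I \<union> J) (\<lambda>_. std_normal))
      {f \<in> space (PiM (I \<union> J) (\<lambda>_. std_normal)). sqrt (\<Sum>i\<in>J. (f i)\<^sup>2) < t * sqrt (\<Sum>i\<in>I. (f i)\<^sup>2)} =
    (\<integral>\<^sup>+u. \<integral>\<^sup>+w. ennreal (chi_density (card I) u) * ennreal (chi_density (card J) w) * indicator {..<t * u} w \<partial>lborel \<partial>lborel)"
proof -
  interpret P: product_sigma_finite "\<lambda>_::'a. std_normal"
    by (intro product_sigma_finite.intro) (rule std_normal.sigma_finite_measure_axioms)
  let ?E = "{f \<in> space (PiM (I \<union> J) (\<lambda>_. std_normal)). sqrt (\<Sum>i\<in>J. (f i)\<^sup>2) < t * sqrt (\<Sum>i\<in>I. (f i)\<^sup>2)}"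
  define G where "G u = (\<integral>\<^sup>+w. ennreal (chi_density (card J) w) * indicator {..<t * u} w \<partial>lborel)" for u
  have [measurable]: "Measurable.pred (borel \<Otimes>\<^sub>M borel) (\<lambda>x. snd x \<in> {..<t * fst x})"
    unfolding lessThan_iff by measurable
  have [measurable]: "G \<in> borel_measurable borel"
    unfolding G_def by measurable
  have [measurable]: "?E \<in> sets (PiM (I \<union> J) (\<lambda>_. std_normal))"
    by measurable
  have "emeasure (PiM (I \<union> J) (\<lambda>_. std_normal)) ?E = (\<integral>\<^sup>+f. indicator ?E f \<partial>PiM (I \<union> J) (\<lambda>_. std_normal))"
    by simp
  also have "\<dots> = (\<integral>\<^sup>+x. \<integral>\<^sup>+y. indicator ?E (merge I J (x, y)) \<partial>PiM J (\<lambda>_. std_normal) \<partial>PiM I (\<lambda>_. std_normal))"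
    by (rule P.product_nn_integral_fold[OF disj I(1) J(1)]) measurable
  also have "\<dots> = (\<integral>\<^sup>+x. \<integral>\<^sup>+y. indicator {..<t * sqrt (\<Sum>i\<in>I. (x i)\<^sup>2)} (sqrt (\<Sum>i\<in>J. (y i)\<^sup>2))
      \<partial>PiM J (\<lambda>_. std_normal) \<partial>PiM I (\<lambda>_. std_normal))"
  proof (intro nn_integral_cong)
    fix x y assume xy: "x \<in> space (PiM I (\<lambda>_. std_normal))" "y \<in> space (PiM J (\<lambda>_. std_normal))"
    have "merge I J (x, y) \<in> space (PiM (I \<union> J) (\<lambda>_. std_normal))"
      using xy by (auto simp: space_PiM)
    moreover have "(\<Sum>i\<in>I. (merge I J (x, y) i)\<^sup>2) = (\<Sum>i\<in>I. (x i)\<^sup>2)" "(\<Sum>i\<in>J. (merge I J (x, y) i)\<^sup>2) = (\<Sum>i\<in>J. (y i)\<^sup>2)"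
      using disj by (auto intro!: sum.cong simp: merge_def)
    ultimately show "indicator ?E (merge I J (x, y)) = (indicator {..<t * sqrt (\<Sum>i\<in>I. (x i)\<^sup>2)} (sqrt (\<Sum>i\<in>J. (y i)\<^sup>2)) :: ennreal)"
      by (auto simp: indicator_def)
  qed
  also have "\<dots> = (\<integral>\<^sup>+x. \<integral>\<^sup>+w. indicator {..<t * sqrt (\<Sum>i\<in>I. (x i)\<^sup>2)} w
      \<partial>distr (PiM J (\<lambda>_. std_normal)) borel (\<lambda>y. sqrt (\<Sum>i\<in>J. (y i)\<^sup>2)) \<partial>PiM I (\<lambda>_. std_normal))"
    by (intro nn_integral_cong, subst nn_integral_distr) auto
  also have "\<dots> = (\<integral>\<^sup>+x. G (sqrt (\<Sum>i\<in>I. (x i)\<^sup>2)) \<partial>PiM I (\<lambda>_. std_normal))"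
    unfolding distr_PiM_std_normal_norm[OF J] G_def
    by (intro nn_integral_cong nn_integral_density) auto
  also have "\<dots> = (\<integral>\<^sup>+u. G u \<partial>distr (PiM I (\<lambda>_. std_normal)) borel (\<lambda>x. sqrt (\<Sum>i\<in>I. (x i)\<^sup>2)))"
    by (rule nn_integral_distr[symmetric]) auto
  also have "\<dots> = (\<integral>\<^sup>+u. ennreal (chi_density (card I) u) * G u \<partial>lborel)"
    unfolding distr_PiM_std_normal_norm[OF I] by (rule nn_integral_density) auto
  also have "\<dots> = (\<integral>\<^sup>+u. \<integral>\<^sup>+w. ennreal (chi_density (card I) u) * ennreal (chi_density (card J) w) * indicator {..<t * u} w \<partial>lborel \<partial>lborel)"
    unfolding G_def mult.assoc by (intro nn_integral_cong nn_integral_cmult[symmetric]) auto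
  finally show ?thesis .
qed

section \<open>The ratio of two independent chi variables\<close>

text \<open>This is 2 / Beta(m/2, d/2), the normalising constant of the density proportional to
  \<open>v ^ (m - 1) / sqrt (1 + v\<^sup>2) ^ (m + d)\<close> of the ratio of independent chi
  variables with \<open>m\<close> and \<open>d\<close> degrees of freedom.\<close>

definition cone_const :: "nat \<Rightarrow> nat \<Rightarrow> real" where
  "cone_const m d = 2 * Gamma (real (m + d) / 2) / (Gamma (real m / 2) * Gamma (real d / 2))"

lemma cone_const_pos: "m > 0 \<Longrightarrow> d > 0 \<Longrightarrow> cone_const m d > 0"
  by (simp add: cone_const_def Gamma_real_pos)

lemma nn_integral_chi_density_scaled:
  assumes "m > 0" "s > 0"
  shows "(\<integral>\<^sup>+u. ennreal (chi_density m (s * u)) \<partial>lborel) = ennreal (1 / s)"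
proof -
  have "1 = ennreal s * (\<integral>\<^sup>+u. ennreal (chi_density m (s * u)) \<partial>lborel)"
    using nn_integral_real_affine[of "\<lambda>u. ennreal (chi_density m u)" s 0] assms
    by (simp add: nn_integral_chi_density)
  then have "ennreal (1 / s) = ennreal (1 / s) * (ennreal s * (\<integral>\<^sup>+u. ennreal (chi_density m (s * u)) \<partial>lborel))"
    by simp
  also have "\<dots> = ennreal (1 / s * s) * (\<integral>\<^sup>+u. ennreal (chi_density m (s * u)) \<partial>lborel)"
  proof -
    have "ennreal (1 / s * s) = ennreal (1 / s) * ennreal s"
      using assms by (intro ennreal_mult) auto
    then show ?thesis by (simp only: mult.assoc)
  qed
  finally show ?thesis using assms by simp
qed

lemma Gamma_half_plus1:
  assumes "m > 0"
  shows "Gamma (real m / 2 + 1) = real m / 2 * Gamma (real m / 2)"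
proof (rule Gamma_plus1)
  show "real m / 2 \<notin> \<int>\<^sub>\<le>\<^sub>0"
    using assms nonpos_Ints_nonpos[of "real m / 2"] by auto
qed

lemma sphere_area_eq:
  "m > 0 \<Longrightarrow> real m * unit_ball_vol (real m) = 2 * pi powr (real m / 2) / Gamma (real m / 2)"
  by (simp add: unit_ball_vol_def Gamma_half_plus1)

text \<open>Since u^2 + (u v)^2 = (1 + v^2) u^2, the Gaussian factors merge, and the dependence on
  \<open>u\<close> is again that of a chi density, now with \<open>m + d\<close> degrees of freedom.
  The leading \<open>u\<close> is the Jacobian of w = u v.\<close>

lemma chi_density_product:
  assumes "m > 0" "d > 0" "u > 0" "v \<ge> 0"
  shows "u * (chi_density d u * chi_density m (u * v)) =
    cone_const m d * v ^ (m - 1) / sqrt (1 + v\<^sup>2) ^ (m + d - 1) * chi_density (m + d) (sqrt (1 + v\<^sup>2) * u)"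
proof -
  define s where "s = sqrt (1 + v\<^sup>2)"
  have s: "s > 0" "s\<^sup>2 = 1 + v\<^sup>2" by (auto simp: s_def add_pos_nonneg)
  have E: "exp (- u\<^sup>2 / 2) * exp (- (u * v)\<^sup>2 / 2) = exp (- (s * u)\<^sup>2 / 2)"
    by (simp add: exp_add[symmetric] power_mult_distrib s(2) field_simps)
  have "u * (u ^ (d - 1) * (u * v) ^ (m - 1)) * s ^ (m + d - 1) = v ^ (m - 1) * (s * u) ^ (m + d - 1)"
  proof -
    obtain m' d' where "m = Suc m'" "d = Suc d'" using assms gr0_implies_Suc by blast
    then show ?thesis by (simp add: power_mult_distrib power_add mult_ac)
  qed
  then have P: "u * (u ^ (d - 1) * (u * v) ^ (m - 1)) = v ^ (m - 1) * (s * u) ^ (m + d - 1) / s ^ (m + d - 1)"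
    using s(1) by (simp add: field_simps)
  \<comment> \<open>The powers of pi and of \<open>sqrt (2 * pi)\<close> cancel in the quotient of
    the constants, which leaves the Gamma factors of \<open>cone_const\<close>.\<close>
  have K: "(real d * unit_ball_vol (real d) / sqrt (2 * pi) ^ d) * (real m * unit_ball_vol (real m) / sqrt (2 * pi) ^ m) =
      cone_const m d * (real (m + d) * unit_ball_vol (real (m + d)) / sqrt (2 * pi) ^ (m + d))"
  proof -
    have "(2 * a / gd / x) * (2 * b / gm / y) = 2 * g / (gm * gd) * (2 * (b * a) / g / (y * x))"
      if "g \<noteq> 0" for a b g gm gd x y :: real
      using that by (simp add: mult_ac)
    moreover have "pi powr (real (m + d) / 2) = pi powr (real m / 2) * pi powr (real d / 2)"
      by (simp add: add_divide_distrib powr_add)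
    moreover have "Gamma (real (m + d) / 2) \<noteq> 0"
      using assms by (intro less_imp_neq[symmetric] Gamma_real_pos) auto
    ultimately show ?thesis
      unfolding sphere_area_eq[OF assms(1)] sphere_area_eq[OF assms(2)]
        sphere_area_eq[of "m + d", OF add_pos_pos[OF assms(1,2)]] cone_const_def power_add
      by (simp only:)
  qed
  have prod: "u * (Kd * ud * e1 * (Km * uv * e2)) = C * vm / S * (K * su * e3)"
    if "e1 * e2 = e3" "u * (ud * uv) = vm * su / S" "Kd * Km = C * K"
    for Kd Km K ud uv vm su S C e1 e2 e3 :: real
  proof -
    have "u * (Kd * ud * e1 * (Km * uv * e2)) = (Kd * Km) * (u * (ud * uv)) * (e1 * e2)"
      by (simp only: mult_ac)
    also have "\<dots> = C * vm / S * (K * su * e3)" unfolding that by simp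
    finally show ?thesis .
  qed
  have chi: "chi_density n x = real n * unit_ball_vol (real n) / sqrt (2 * pi) ^ n * x ^ (n - 1) * exp (- x\<^sup>2 / 2)"
    if "x \<ge> 0" for n x
    using that by (simp add: chi_density_def)
  have nn: "0 \<le> u" "0 \<le> u * v" "0 \<le> s * u" using assms s(1) by simp_all
  show ?thesis
    unfolding s_def[symmetric] nn[THEN chi] by (rule prod[OF E P K])
qed

text \<open>For fixed \<open>u\<close> the substitution w = u v turns the cone condition into v < t,
  free of \<open>u\<close>. After the integrals are exchanged, the chi density in \<open>u\<close>
  integrates to 1 / sqrt (1 + v^2), the last power in the denominator.\<close>

lemma cone_integral:
  assumes md: "m > 0" "d > 0"
  shows "(\<integral>\<^sup>+u. \<integral>\<^sup>+w. ennreal (chi_density d u) * ennreal (chi_density m w) * indicator {..<t * u} w \<partial>lborel \<partial>lborel) =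
    (\<integral>\<^sup>+v. ennreal (cone_const m d * v ^ (m - 1) / sqrt (1 + v\<^sup>2) ^ (m + d)) * indicator {0..<t} v \<partial>lborel)"
proof -
  let ?c = "\<lambda>v. cone_const m d * v ^ (m - 1) / sqrt (1 + v\<^sup>2) ^ (m + d - 1)"
  have "(\<integral>\<^sup>+u. \<integral>\<^sup>+w. ennreal (chi_density d u) * ennreal (chi_density m w) * indicator {..<t * u} w \<partial>lborel \<partial>lborel) =
      (\<integral>\<^sup>+u. \<integral>\<^sup>+v. ennreal (?c v) * indicator {0..<t} v * ennreal (chi_density (m + d) (sqrt (1 + v\<^sup>2) * u)) \<partial>lborel \<partial>lborel)"
  proof (rule nn_integral_cong_AE)
    \<comment> \<open>The substitution divides by \<open>u\<close>; for negative \<open>u\<close>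
      both sides vanish.\<close>
    have "AE u in lborel. u \<noteq> (0::real)" by (rule AE_lborel_singleton)
    then show "AE u in lborel. (\<integral>\<^sup>+w. ennreal (chi_density d u) * ennreal (chi_density m w) * indicator {..<t * u} w \<partial>lborel) =
      (\<integral>\<^sup>+v. ennreal (?c v) * indicator {0..<t} v * ennreal (chi_density (m + d) (sqrt (1 + v\<^sup>2) * u)) \<partial>lborel)"
    proof eventually_elim
      case (elim u)
      show ?case
      proof (cases "u > 0")
        case True
        have "(\<integral>\<^sup>+w. ennreal (chi_density d u) * ennreal (chi_density m w) * indicator {..<t * u} w \<partial>lborel) =
          ennreal u * (\<integral>\<^sup>+v. ennreal (chi_density d u) * ennreal (chi_density m (u * v)) * indicator {..<t * u} (u * v) \<partial>lborel)"
          using True by (subst nn_integral_real_affine[where c = u and t = 0]) auto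
        also have "\<dots> = (\<integral>\<^sup>+v. ennreal u * (ennreal (chi_density d u) * ennreal (chi_density m (u * v)) * indicator {..<t * u} (u * v)) \<partial>lborel)"
          by (rule nn_integral_cmult[symmetric]) measurable
        also have "\<dots> = (\<integral>\<^sup>+v. ennreal (?c v) * indicator {0..<t} v * ennreal (chi_density (m + d) (sqrt (1 + v\<^sup>2) * u)) \<partial>lborel)"
        proof (rule nn_integral_cong)
          fix v :: real
          show "ennreal u * (ennreal (chi_density d u) * ennreal (chi_density m (u * v)) * indicator {..<t * u} (u * v)) =
            ennreal (?c v) * indicator {0..<t} v * ennreal (chi_density (m + d) (sqrt (1 + v\<^sup>2) * u))"
          proof (cases "v \<ge> 0 \<and> v < t")
            case v: True
            have "u * v < t * u" using v True by (simp add: mult.commute)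
            then have "ennreal u * (ennreal (chi_density d u) * ennreal (chi_density m (u * v)) * indicator {..<t * u} (u * v)) =
                ennreal (u * (chi_density d u * chi_density m (u * v)))"
              using True by (simp add: ennreal_mult)
            also have "\<dots> = ennreal (?c v) * ennreal (chi_density (m + d) (sqrt (1 + v\<^sup>2) * u))"
              unfolding chi_density_product[OF md True conjunct1[OF v]]
              using v cone_const_pos[OF md] by (intro ennreal_mult) auto
            finally show ?thesis using v by simp
          next
            case v: False
            \<comment> \<open>A negative \<open>v\<close> puts a negative argument into the chi
              density, and a \<open>v\<close> not below \<open>t\<close> violates the cone
              condition.\<close>
            have "chi_density m (u * v) = 0 \<or> \<not> u * v < t * u"
              using v True by (auto simp: chi_density_def indicator_def zero_le_mult_iff mult.commute[of t])
            then show ?thesis using v by (auto simp: indicator_def)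
          qed
        qed
        finally show ?thesis .
      next
        case False
        with elim have "u < 0" by auto
        then have "chi_density d u = 0" "chi_density (m + d) (sqrt (1 + v\<^sup>2) * u) = 0" for v
          by (auto simp: chi_density_def indicator_def zero_le_mult_iff add_pos_nonneg not_le dest!: spec)
        then show ?thesis by simp
      qed
    qed
  qed
  also have "\<dots> = (\<integral>\<^sup>+v. \<integral>\<^sup>+u. ennreal (?c v) * indicator {0..<t} v * ennreal (chi_density (m + d) (sqrt (1 + v\<^sup>2) * u)) \<partial>lborel \<partial>lborel)"
    by (rule lborel_pair.Fubini'[symmetric]) measurable
  also have "\<dots> = (\<integral>\<^sup>+v. ennreal (cone_const m d * v ^ (m - 1) / sqrt (1 + v\<^sup>2) ^ (m + d)) * indicator {0..<t} v \<partial>lborel)"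
  proof (rule nn_integral_cong)
    fix v :: real
    have s: "sqrt (1 + v\<^sup>2) > 0" by (simp add: add_pos_nonneg)
    have "(\<integral>\<^sup>+u. ennreal (?c v) * indicator {0..<t} v * ennreal (chi_density (m + d) (sqrt (1 + v\<^sup>2) * u)) \<partial>lborel) =
        ennreal (?c v) * indicator {0..<t} v * ennreal (1 / sqrt (1 + v\<^sup>2))"
      using md s by (subst nn_integral_cmult) (auto simp: nn_integral_chi_density_scaled)
    also have "\<dots> = ennreal (cone_const m d * v ^ (m - 1) / sqrt (1 + v\<^sup>2) ^ (m + d)) * indicator {0..<t} v"
    proof (cases "v \<ge> 0")
      case True
      have "sqrt (1 + v\<^sup>2) ^ (m + d) = sqrt (1 + v\<^sup>2) ^ (m + d - 1) * sqrt (1 + v\<^sup>2)"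
        using md by (subst power_Suc2[symmetric]) simp
      then have "?c v * (1 / sqrt (1 + v\<^sup>2)) = cone_const m d * v ^ (m - 1) / sqrt (1 + v\<^sup>2) ^ (m + d)"
        by simp
      moreover have "ennreal (?c v) * ennreal (1 / sqrt (1 + v\<^sup>2)) = ennreal (?c v * (1 / sqrt (1 + v\<^sup>2)))"
        using True cone_const_pos[OF md] s by (intro ennreal_mult[symmetric]) auto
      ultimately have "ennreal (?c v) * ennreal (1 / sqrt (1 + v\<^sup>2)) = ennreal (cone_const m d * v ^ (m - 1) / sqrt (1 + v\<^sup>2) ^ (m + d))"
        by (simp only:)
      moreover have "ennreal (?c v) * indicator {0..<t} v * ennreal (1 / sqrt (1 + v\<^sup>2)) =
          ennreal (?c v) * ennreal (1 / sqrt (1 + v\<^sup>2)) * indicator {0..<t} v"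
        by (simp only: mult_ac)
      ultimately show ?thesis by (simp only:)
    qed (simp add: indicator_def)
    finally show "(\<integral>\<^sup>+u. ennreal (?c v) * indicator {0..<t} v * ennreal (chi_density (m + d) (sqrt (1 + v\<^sup>2) * u)) \<partial>lborel) = \<dots>" .
  qed
  finally show ?thesis .
qed

section \<open>Comparison of \<tau> with the integral of the ratio density\<close>

lemma sqrt_1_plus_square_deriv:
  "((\<lambda>v. sqrt (1 + v\<^sup>2)) has_real_derivative v / sqrt (1 + v\<^sup>2)) (at v within S)"
proof -
  have "1 + v\<^sup>2 > 0" by (simp add: add_pos_nonneg)
  then show ?thesis
    by (auto intro!: derivative_eq_intros simp: field_simps)
qed

text \<open>Extracting m / 2 from Gamma (m / 2 + 1) produces the division by \<open>m\<close>. This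
  links the binomial coefficient in \<open>tau\<close> to the ratio density.\<close>

lemma real_binomial_eq_cone_const:
  assumes "m > 0" "real N = real m + real d"
  shows "real_binomial ((real N - 2) / 2) (real m / 2) = cone_const m d / m"
proof -
  have eq: "(real N - 2) / 2 + 1 = real (m + d) / 2" "(real N - 2) / 2 - real m / 2 + 1 = real d / 2"
    using assms(2) by (simp_all add: field_simps)
  show ?thesis
    unfolding real_binomial_def cone_const_def eq Gamma_half_plus1[OF assms(1)] by (simp add: mult_ac)
qed

text \<open>The endpoint \<open>t\<close> is the tangent of the angle whose sine is
  \<open>r\<close>. For d = 1 the substitution v = tan x gives equality. For larger
  \<open>d\<close>, \<open>tau\<close> is the increment over the interval of a function whose
  derivative is at most the integrand.\<close>

lemma tau_le_integral:
  fixes r :: real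
  assumes r: "0 < r" "r < 1" and d: "1 \<le> d" "d < N"
  defines "t \<equiv> r / sqrt (1 - r\<^sup>2)" and "m \<equiv> N - d"
  shows "tau r d N \<le> integral {0..t} (\<lambda>v. cone_const m d * v ^ (m - 1) / sqrt (1 + v\<^sup>2) ^ (m + d))"
proof -
  let ?g = "\<lambda>v::real. cone_const m d * v ^ (m - 1) / sqrt (1 + v\<^sup>2) ^ (m + d)"
  have r2: "r\<^sup>2 < 1" using r by (simp add: abs_square_less_1)
  have t: "t > 0" using r r2 by (simp add: t_def)
  have m: "m > 0" using d by (simp add: m_def)
  have N: "real N = real m + real d" using d by (simp add: m_def)
  have q0: "sqrt (1 + v\<^sup>2) \<noteq> 0" for v :: real
    by (metis add_pos_nonneg less_irrefl real_sqrt_gt_zero zero_le_power2 zero_less_one)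
  have g_cont: "continuous_on {0..t} ?g"
    using q0 by (intro continuous_intros) auto
  have q2: "(sqrt (1 + v\<^sup>2))\<^sup>2 = 1 + v\<^sup>2" for v :: real by simp
  show ?thesis
  proof (cases "d = 1")
    case True
    define H where "H \<phi> = integral {0..\<phi>} (\<lambda>x. sin x ^ (m - 1))" for \<phi> :: real
    define \<alpha> where "\<alpha> = arctan t"
    have \<alpha>: "\<alpha> = arcsin r" unfolding \<alpha>_def t_def using r by (simp add: arcsin_arctan)
    have "(?g has_integral cone_const m d * H (arctan t) - cone_const m d * H (arctan 0)) {0..t}"
    proof (rule fundamental_theorem_of_calculus)
      fix v assume v: "v \<in> {0..t}"
      \<comment> \<open>\<open>H\<close> is differentiated relative to {0..\<alpha>}, so the chain
        rule is applied within the image of the interval under arctan.\<close>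
      have img: "arctan ` {0..t} \<subseteq> {0..\<alpha>}" by (auto simp: \<alpha>_def arctan_le_iff)
      have "(H has_real_derivative sin (arctan v) ^ (m - 1)) (at (arctan v) within {0..\<alpha>})"
        unfolding H_def using v img by (intro integral_has_real_derivative continuous_intros) blast
      then have "(H has_real_derivative sin (arctan v) ^ (m - 1)) (at (arctan v) within arctan ` {0..t})"
        using img by (rule has_field_derivative_subset)
      then have "((\<lambda>v. H (arctan v)) has_real_derivative sin (arctan v) ^ (m - 1) * inverse (1 + v\<^sup>2)) (at v within {0..t})"
        using DERIV_image_chain[of H _ arctan v "{0..t}" "inverse (1 + v\<^sup>2)"]
          has_field_derivative_at_within[OF DERIV_arctan[of v]] by (simp add: comp_def)
      then have "((\<lambda>v. cone_const m d * H (arctan v)) has_real_derivative cone_const m d * (sin (arctan v) ^ (m - 1) * inverse (1 + v\<^sup>2))) (at v within {0..t})"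
        by (rule DERIV_cmult)
      also have "cone_const m d * (sin (arctan v) ^ (m - 1) * inverse (1 + v\<^sup>2)) = ?g v"
      proof -
        \<comment> \<open>As d = 1, the exponent is (m - 1) + 2: the sine takes m - 1 powers, the
          derivative of arctan the other two.\<close>
        have "sqrt (1 + v\<^sup>2) ^ (m + d) = sqrt (1 + v\<^sup>2) ^ (m - 1) * (sqrt (1 + v\<^sup>2))\<^sup>2"
          using m True by (subst power_add[symmetric]) simp
        then show ?thesis by (simp add: sin_arctan power_divide q2 field_simps)
      qed
      finally show "((\<lambda>v. cone_const m d * H (arctan v)) has_vector_derivative ?g v) (at v within {0..t})"
        by (simp add: has_real_derivative_iff_has_vector_derivative)
    qed (use t in auto)
    then have "integral {0..t} ?g = cone_const m d * H \<alpha>"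
      by (simp add: integral_unique H_def \<alpha>_def)
    moreover have "tau r d N = cone_const m d * H \<alpha>"
    proof -
      have "(real N - 1) * real_binomial ((real N - 2) / 2) ((real N - 1) / 2) = cone_const m d"
        using real_binomial_eq_cone_const[OF m N] m N True by simp
      moreover have "N - 2 = m - 1" using True by (simp add: m_def)
      ultimately show ?thesis by (simp add: tau_def True H_def \<alpha>)
    qed
    ultimately show ?thesis by simp
  next
    case False
    then have d2: "d \<ge> 2" using d by simp
    define n where "n = m + d - 2"
    have n: "m + d = n + 2" "real n = real m + real d - 2" using d2 by (auto simp: n_def)
    \<comment> \<open>This is the expression for \<open>tau\<close> with \<open>r\<close> replaced
      by v / sqrt (1 + v^2), the sine of the angle with tangent \<open>v\<close>. Its derivative
      \<open>\<psi>\<close> is the integrand times a factor that is at most 1 because d >=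
      2.\<close>
    define \<Psi> where "\<Psi> v = cone_const m d / m * v ^ m / sqrt (1 + v\<^sup>2) ^ n" for v :: real
    define \<psi> where "\<psi> v = ?g v * (1 - (real d - 2) / m * v\<^sup>2)" for v :: real
    have "(\<psi> has_integral \<Psi> t - \<Psi> 0) {0..t}"
    proof (rule fundamental_theorem_of_calculus)
      fix v assume v: "v \<in> {0..t}"
      define q where "q = sqrt (1 + v\<^sup>2)"
      have q: "q \<noteq> 0" "q\<^sup>2 = 1 + v\<^sup>2" using q0 by (auto simp: q_def)
      have "((\<lambda>v. cone_const m d / m * v ^ m) has_real_derivative cone_const m d / m * (m * v ^ (m - 1))) (at v within {0..t})"
        by (rule DERIV_cmult) (auto intro!: derivative_eq_intros)
      moreover have "((\<lambda>v. sqrt (1 + v\<^sup>2) ^ n) has_real_derivative n * q ^ (n - 1) * (v / q)) (at v within {0..t})"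
        by (rule DERIV_cong[OF DERIV_power[OF sqrt_1_plus_square_deriv]]) (simp add: q_def)
      ultimately have "(\<Psi> has_real_derivative
          (cone_const m d / m * (m * v ^ (m - 1)) * q ^ n - cone_const m d / m * v ^ m * (n * q ^ (n - 1) * (v / q))) / (q ^ n * q ^ n)) (at v within {0..t})"
        unfolding \<Psi>_def using q0[of v] by (intro DERIV_cong[OF DERIV_divide]) (auto simp: q_def)
      also have "(cone_const m d / m * (m * v ^ (m - 1)) * q ^ n - cone_const m d / m * v ^ m * (n * q ^ (n - 1) * (v / q))) / (q ^ n * q ^ n) = \<psi> v"
      proof -
        have vm: "v ^ m = v * v ^ (m - 1)" using m by (cases m) auto
        have qn: "n * q ^ (n - 1) = n * q ^ n / q" using q by (cases n) auto
        have "(cone_const m d / m * (m * v ^ (m - 1)) * q ^ n - cone_const m d / m * v ^ m * (n * q ^ (n - 1) * (v / q))) / (q ^ n * q ^ n)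
           = cone_const m d * v ^ (m - 1) / q ^ n * (1 - real n / m * v\<^sup>2 / q\<^sup>2)"
          unfolding vm qn using q m by (simp add: field_simps power2_eq_square)
        also have "1 - real n / m * v\<^sup>2 / q\<^sup>2 = (1 - (real d - 2) / m * v\<^sup>2) / q\<^sup>2"
        proof -
          have "1 - real n / m * v\<^sup>2 / q\<^sup>2 = (q\<^sup>2 - real n / m * v\<^sup>2) / q\<^sup>2"
            using q(1) by (simp add: diff_divide_distrib)
          also have "q\<^sup>2 - real n / m * v\<^sup>2 = 1 - (real d - 2) / m * v\<^sup>2"
            using m unfolding n(2) q(2) by (simp add: field_simps)
          finally show ?thesis .
        qed
        finally show ?thesis
          unfolding \<psi>_def q_def[symmetric] n(1) by (simp add: power_add power2_eq_square[of q])
      qed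
      finally show "(\<Psi> has_vector_derivative \<psi> v) (at v within {0..t})"
        by (simp add: has_real_derivative_iff_has_vector_derivative)
    qed (use t in auto)
    moreover have "(?g has_integral integral {0..t} ?g) {0..t}"
      using g_cont by (intro integrable_integral integrable_continuous_real)
    moreover have "\<psi> v \<le> ?g v" if "v \<in> {0..t}" for v
    proof -
      have "?g v \<ge> 0" using that cone_const_pos[OF m, of d] d by auto
      moreover have "1 - (real d - 2) / m * v\<^sup>2 \<le> 1" using d2 by simp
      ultimately show ?thesis unfolding \<psi>_def by (metis mult.right_neutral mult_left_mono)
    qed
    ultimately have "\<Psi> t - \<Psi> 0 \<le> integral {0..t} ?g"
      by (rule has_integral_le)
    moreover have "\<Psi> 0 = 0" using m by (simp add: \<Psi>_def power_0_left)
    moreover have "\<Psi> t = tau r d N"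
    proof -
      \<comment> \<open>With sine \<open>r\<close> and cosine \<open>q\<close> of the same angle, t
        = r / q and sqrt (1 + t^2) = 1 / q.\<close>
      define q where "q = sqrt (1 - r\<^sup>2)"
      have q: "q > 0" "q\<^sup>2 = 1 - r\<^sup>2" using r2 by (auto simp: q_def)
      have "1 + t\<^sup>2 = (1 / q)\<^sup>2"
        using q by (simp add: t_def q_def[symmetric] power_divide field_simps)
      then have "sqrt (1 + t\<^sup>2) = 1 / q" using q by simp
      then have "t ^ m / sqrt (1 + t\<^sup>2) ^ n = r ^ m * q ^ (d - 2)"
      proof -
        have "n = m + (d - 2)" using d2 by (simp add: n_def)
        moreover have "t = r / q" by (simp add: t_def q_def)
        ultimately show ?thesis using q(1)
          unfolding \<open>sqrt (1 + t\<^sup>2) = 1 / q\<close> by (simp add: power_divide power_add)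
      qed
      moreover have "q ^ (d - 2) = (1 - r\<^sup>2) powr ((real d - 2) / 2)"
      proof -
        have "q = (1 - r\<^sup>2) powr (1 / 2)" using r2 by (simp add: q_def powr_half_sqrt)
        then have "q ^ (d - 2) = (1 - r\<^sup>2) powr (1 / 2 * real (d - 2))"
          using r2 by (simp add: powr_realpow[symmetric] powr_powr)
        also have "1 / 2 * real (d - 2) = (real d - 2) / 2" using d2 by simp
        finally show ?thesis .
      qed
      moreover have "real_binomial ((real N - 2) / 2) ((real N - real d) / 2) = cone_const m d / m"
        using real_binomial_eq_cone_const[OF m N] N by simp
      moreover have "\<Psi> t = cone_const m d / m * (t ^ m / sqrt (1 + t\<^sup>2) ^ n)" by (simp add: \<Psi>_def)
      ultimately show ?thesis
        using False unfolding tau_def m_def[symmetric] by (simp del: times_divide_eq_left times_divide_eq_right)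
    qed
    ultimately show ?thesis by simp
  qed
qed

text \<open>An orthogonal transformation maps a coordinate subspace onto \<open>V\<close>. The
  distance to that coordinate subspace is the norm of the remaining coordinates, so a small angle is
  a comparison of the norms of two independent blocks.\<close>

lemma gauss_cone_ge_tau:
  fixes V :: "'a::euclidean_space set"
  assumes V: "subspace V" "dim V = d" and d: "1 \<le> d" "d < DIM('a)" and r: "0 < r" "r < 1"
  shows "ennreal (tau r d DIM('a)) \<le> emeasure gauss {x. \<exists>v\<in>V. norm (v - x) < r * norm x}"
proof -
  define t where "t = r / sqrt (1 - r\<^sup>2)"
  let ?S = "{x. \<exists>v\<in>V. norm (v - x) < r * norm x}"
  have r2: "r\<^sup>2 < 1" using r by (simp add: abs_square_less_1)
  obtain B where B: "B \<subseteq> V" "pairwise orthogonal B" "\<And>x. x \<in> B \<Longrightarrow> norm x = 1" "independent B" "card B = dim V" "span B = V"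
    using orthonormal_basis_subspace[OF V(1)] by metis
  have "finite B" using B(4) by (rule independent_imp_finite)
  have B_inner: "b \<bullet> c = of_bool (b = c)" if "b \<in> B" "c \<in> B" for b c
    using B(2,3) that by (auto simp: pairwise_def orthogonal_def norm_eq_1)
  obtain T :: "'a \<Rightarrow> 'a" and e where T: "orthogonal_transformation T" and e: "inj_on e B" "e ` B \<subseteq> Basis" "\<And>b. b \<in> B \<Longrightarrow> T (e b) = b"
    using orthonormal_family_eq_image_Basis[OF \<open>finite B\<close> B_inner] by metis
  define I where "I = e ` B"
  define J where "J = Basis - I"
  have IJ: "I \<union> J = Basis" "I \<inter> J = {}" "finite I" "finite J"
    using e(2) \<open>finite B\<close> by (auto simp: I_def J_def)
  have cardI: "card I = d" using B(5) V(2) e(1) by (simp add: I_def card_image)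
  have cardJ: "card J = DIM('a) - d" using IJ cardI unfolding J_def by (subst card_Diff_subset) auto
  have TV: "T b \<in> V" if "b \<in> I" for b using that e(3) B(1) by (auto simp: I_def)
  have lin: "linear T" using T by (rule orthogonal_transformation_linear)
  have [measurable]: "T \<in> borel_measurable borel" using lin by (rule borel_measurable_linear)
  have S: "?S \<in> sets borel"
  proof -
    have "?S = (\<Union>v\<in>V. {x. norm (v - x) < r * norm x})" by auto
    also have "open \<dots>" by (intro open_UN ballI open_Collect_less continuous_intros)
    finally show ?thesis by simp
  qed
  have g0: "cone_const (card J) (card I) * v ^ (card J - 1) / sqrt (1 + v\<^sup>2) ^ (card J + card I) \<ge> 0" if "v \<ge> 0" for v
    using that d cardI cardJ by (auto intro!: divide_nonneg_nonneg mult_nonneg_nonneg less_imp_le[OF cone_const_pos])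
  let ?g = "\<lambda>v. cone_const (card J) (card I) * v ^ (card J - 1) / sqrt (1 + v\<^sup>2) ^ (card J + card I)"
  have q0: "sqrt (1 + v\<^sup>2) \<noteq> 0" for v :: real
    by (metis add_pos_nonneg less_irrefl real_sqrt_gt_zero zero_le_power2 zero_less_one)
  have "ennreal (tau r d DIM('a)) \<le> ennreal (integral {0..t} ?g)"
    using tau_le_integral[OF r d] by (intro ennreal_leI) (simp add: t_def cardI cardJ)
  also have "\<dots> = (\<integral>\<^sup>+v. ennreal (indicator {0..t} v * ?g v) \<partial>lborel)"
  proof -
    have "(?g has_integral integral {0..t} ?g) {0..t}"
      using q0 by (intro integrable_integral integrable_continuous_real continuous_intros) auto
    then show ?thesis using g0
      by (intro nn_integral_has_integral_lebesgue[symmetric]) auto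
  qed
  also have "\<dots> = (\<integral>\<^sup>+v. ennreal (?g v) * indicator {0..<t} v \<partial>lborel)"
  proof (rule nn_integral_cong_AE)
    have "AE v in lborel. v \<noteq> t" by (rule AE_lborel_singleton)
    then show "AE v in lborel. ennreal (indicator {0..t} v * ?g v) = ennreal (?g v) * indicator {0..<t} v"
      by eventually_elim (auto simp: indicator_def)
  qed
  also have "\<dots> = emeasure (PiM (I \<union> J) (\<lambda>_. std_normal))
      {f \<in> space (PiM (I \<union> J) (\<lambda>_. std_normal)). sqrt (\<Sum>i\<in>J. (f i)\<^sup>2) < t * sqrt (\<Sum>i\<in>I. (f i)\<^sup>2)}"
  proof -
    have "card I > 0" "card J > 0" using d cardI cardJ by auto
    then have ne: "I \<noteq> {}" "J \<noteq> {}" by auto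
    show ?thesis
      unfolding emeasure_PiM_std_normal_cone[OF IJ(3) ne(1) IJ(4) ne(2) IJ(2)]
        cone_integral[OF \<open>card J > 0\<close> \<open>card I > 0\<close>] ..
  qed
  also have "\<dots> = emeasure (distr gauss (PiM Basis (\<lambda>_. borel)) (\<lambda>x. \<lambda>b\<in>Basis. x \<bullet> b))
      {f \<in> space (PiM Basis (\<lambda>_. borel)). sqrt (\<Sum>i\<in>J. (f i)\<^sup>2) < t * sqrt (\<Sum>i\<in>I. (f i)\<^sup>2)}"
    unfolding IJ(1) by (subst distr_gauss_orthonormal_coordinates) (auto simp: inner_Basis space_PiM)
  also have "\<dots> = emeasure gauss {x. sqrt (\<Sum>i\<in>J. (x \<bullet> i)\<^sup>2) < t * sqrt (\<Sum>i\<in>I. (x \<bullet> i)\<^sup>2)}"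
  proof -
    have *: "(\<lambda>f. f i) \<in> borel_measurable (PiM (Basis::'a set) (\<lambda>_. borel :: real measure))" if "i \<in> I \<or> i \<in> J" for i
      using that IJ by (intro measurable_component_singleton) auto
    have "(\<Sum>i\<in>J. ((\<lambda>b\<in>Basis. x \<bullet> b) i)\<^sup>2) = (\<Sum>i\<in>J. (x \<bullet> i)\<^sup>2)" "(\<Sum>i\<in>I. ((\<lambda>b\<in>Basis. x \<bullet> b) i)\<^sup>2) = (\<Sum>i\<in>I. (x \<bullet> i)\<^sup>2)" for x
      using IJ by (auto intro!: sum.cong)
    then show ?thesis
      using * by (subst emeasure_distr) (auto simp: space_PiM intro!: arg_cong[where f = "emeasure gauss"])
  qed
  also have "\<dots> \<le> emeasure gauss (T -` ?S)"
  proof (rule emeasure_mono)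
    show "T -` ?S \<in> sets gauss" using measurable_sets[of T borel borel ?S] S by simp
    show "{x. sqrt (\<Sum>i\<in>J. (x \<bullet> i)\<^sup>2) < t * sqrt (\<Sum>i\<in>I. (x \<bullet> i)\<^sup>2)} \<subseteq> T -` ?S"
    proof
      fix x assume x: "x \<in> {x. sqrt (\<Sum>i\<in>J. (x \<bullet> i)\<^sup>2) < t * sqrt (\<Sum>i\<in>I. (x \<bullet> i)\<^sup>2)}"
      define X Y where "X = (\<Sum>i\<in>I. (x \<bullet> i)\<^sup>2)" and "Y = (\<Sum>i\<in>J. (x \<bullet> i)\<^sup>2)"
      have XY: "X \<ge> 0" "Y \<ge> 0" by (auto simp: X_def Y_def sum_nonneg)
      \<comment> \<open>\<open>w\<close> is the projection of \<open>x\<close> to the span of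
        \<open>I\<close>; \<open>T w\<close> lies in \<open>V\<close> and is the witness.\<close>
      define w where "w = (\<Sum>b\<in>I. (x \<bullet> b) *\<^sub>R b)"
      have w: "w \<bullet> b = (if b \<in> I then x \<bullet> b else 0)" if "b \<in> Basis" for b
      proof -
        have "w \<bullet> b = (\<Sum>c\<in>I. (x \<bullet> c) * (c \<bullet> b))" by (simp add: w_def inner_sum_left)
        also have "\<dots> = (\<Sum>c\<in>I. if c = b then x \<bullet> b else 0)"
        proof (intro sum.cong refl)
          fix c assume "c \<in> I"
          then have "c \<in> Basis" using IJ by auto
          then show "(x \<bullet> c) * (c \<bullet> b) = (if c = b then x \<bullet> b else 0)"
            using that by (simp add: inner_Basis)
        qed
        finally show ?thesis using IJ by (simp add: sum.delta)
      qed
      have "(norm (w - x))\<^sup>2 = (\<Sum>b\<in>Basis. ((w - x) \<bullet> b)\<^sup>2)"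
        unfolding power2_norm_eq_inner by (subst euclidean_inner) (simp add: power2_eq_square)
      also have "\<dots> = (\<Sum>b\<in>J. ((w - x) \<bullet> b)\<^sup>2)"
        using IJ by (intro sum.mono_neutral_right) (auto simp: J_def inner_diff_left w)
      also have "\<dots> = Y" unfolding Y_def using IJ by (intro sum.cong) (auto simp: J_def inner_diff_left w)
      finally have nY: "(norm (w - x))\<^sup>2 = Y" .
      have "(norm x)\<^sup>2 = (\<Sum>b\<in>I \<union> J. (x \<bullet> b)\<^sup>2)"
        unfolding power2_norm_eq_inner IJ(1) by (subst euclidean_inner) (simp add: power2_eq_square)
      then have nx: "(norm x)\<^sup>2 = X + Y"
        unfolding X_def Y_def using IJ by (subst (asm) sum.union_disjoint) auto
      have "sqrt Y < t * sqrt X" using x by (simp add: X_def Y_def)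
      then have "(sqrt Y)\<^sup>2 < (t * sqrt X)\<^sup>2" using XY by (intro power_strict_mono) auto
      \<comment> \<open>Comparing Y with X by the squared tangent is the same as comparing Y with X
        + Y by the squared sine.\<close>
      then have "Y < r\<^sup>2 / (1 - r\<^sup>2) * X"
        using XY r2 by (simp add: power_mult_distrib t_def power_divide)
      then have "Y < r\<^sup>2 * (X + Y)" using r2 by (simp add: field_simps)
      then have "(norm (w - x))\<^sup>2 < (r * norm x)\<^sup>2" by (simp add: nY nx power_mult_distrib)
      then have "norm (w - x) < r * norm x" by (rule power_less_imp_less_base) (use r in auto)
      moreover have "norm (T w - T x) = norm (w - x)" "norm (T x) = norm x"
        using orthogonal_transformation_norm[OF T] linear_diff[OF lin] by metis+
      moreover have "T w \<in> V"
        unfolding w_def linear_sum[OF lin] linear_scale[OF lin] using V(1) TV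
        by (intro subspace_sum subspace_scale) auto
      ultimately show "x \<in> T -` ?S" by (auto intro!: bexI[of _ "T w"])
    qed
  qed
  also have "\<dots> = emeasure (distr gauss borel T) ?S"
    using S by (subst emeasure_distr) auto
  also have "\<dots> = emeasure gauss ?S" by (simp add: distr_gauss_orthogonal_transformation[OF T])
  finally show ?thesis .
qed

lemma emeasure_gauss_UNIV [simp]: "emeasure (gauss :: 'a::euclidean_space measure) UNIV = 1"
  using prob_space.emeasure_space_1[OF prob_space_gauss[where 'a = 'a]] by simp

section \<open>Random Gaussian subspaces\<close>

text \<open>Strictness makes the condition open in the coefficients, so that rational ones suffice
  and the predicate is measurable jointly in columns, target and radius.\<close>

definition hits :: "nat \<Rightarrow> (nat \<Rightarrow> 'a::euclidean_space) \<Rightarrow> 'a \<Rightarrow> real \<Rightarrow> bool" where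
  "hits d a x s \<longleftrightarrow> (\<exists>c. norm ((\<Sum>j<d. c j *\<^sub>R a j) - x) < s)"

lemma hits_iff_rational:
  "hits d a x s \<longleftrightarrow> (\<exists>c\<in>PiE {..<d} (\<lambda>_. \<rat>). norm ((\<Sum>j<d. c j *\<^sub>R a j) - x) < s)"
proof
  assume "hits d a x s"
  then obtain c where c: "norm ((\<Sum>j<d. c j *\<^sub>R a j) - x) < s" by (auto simp: hits_def)
  define \<delta> where "\<delta> = s - norm ((\<Sum>j<d. c j *\<^sub>R a j) - x)"
  \<comment> \<open>The summand 1 keeps \<open>A\<close> positive even if all vectors vanish, and
    makes the total error \<open>\<delta> / A * (A - 1)\<close> strictly smaller than
    \<open>\<delta>\<close>.\<close>
  define A where "A = (\<Sum>j<d. norm (a j)) + 1"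
  have A: "A > 0" by (simp add: A_def add_nonneg_pos sum_nonneg)
  have \<delta>: "\<delta> > 0" using c by (simp add: \<delta>_def)
  have "\<exists>q\<in>\<rat>. \<bar>q - c j\<bar> < \<delta> / A" for j
  proof -
    have "c j - \<delta> / A < c j + \<delta> / A" using A \<delta> by simp
    from Rats_dense_in_real[OF this] obtain q where "q \<in> \<rat>" "c j - \<delta> / A < q" "q < c j + \<delta> / A" by auto
    then show ?thesis by (intro bexI[of _ q]) auto
  qed
  then obtain q where q: "\<And>j. q j \<in> \<rat>" "\<And>j. \<bar>q j - c j\<bar> < \<delta> / A" by metis
  have "norm ((\<Sum>j<d. q j *\<^sub>R a j) - (\<Sum>j<d. c j *\<^sub>R a j)) = norm (\<Sum>j<d. (q j - c j) *\<^sub>R a j)"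
    by (simp add: sum_subtractf scaleR_diff_left)
  also have "\<dots> \<le> (\<Sum>j<d. \<bar>q j - c j\<bar> * norm (a j))"
    by (rule order_trans[OF norm_sum]) simp
  also have "\<dots> \<le> (\<Sum>j<d. \<delta> / A * norm (a j))"
    by (intro sum_mono mult_right_mono) (auto intro: less_imp_le q(2))
  also have "\<dots> = \<delta> / A * (A - 1)" by (simp add: sum_distrib_left A_def)
  also have "\<dots> < \<delta>" using A \<delta> by (simp add: field_simps)
  finally have "norm ((\<Sum>j<d. q j *\<^sub>R a j) - (\<Sum>j<d. c j *\<^sub>R a j)) < \<delta>" .
  then have "norm ((\<Sum>j<d. q j *\<^sub>R a j) - x) < s"
    using norm_triangle_ineq[of "(\<Sum>j<d. q j *\<^sub>R a j) - (\<Sum>j<d. c j *\<^sub>R a j)" "(\<Sum>j<d. c j *\<^sub>R a j) - x"]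
    by (simp add: \<delta>_def)
  then show "\<exists>c\<in>PiE {..<d} (\<lambda>_. \<rat>). norm ((\<Sum>j<d. c j *\<^sub>R a j) - x) < s"
    using q(1) by (intro bexI[of _ "restrict q {..<d}"]) auto
qed (auto simp: hits_def)

lemma measurable_hits [measurable (raw)]:
  fixes a :: "'w \<Rightarrow> nat \<Rightarrow> 'a::euclidean_space"
  assumes "\<And>j. j < d \<Longrightarrow> (\<lambda>\<omega>. a \<omega> j) \<in> borel_measurable M"
    and "x \<in> borel_measurable M" "s \<in> borel_measurable M"
  shows "Measurable.pred M (\<lambda>\<omega>. hits d (a \<omega>) (x \<omega>) (s \<omega>))"
proof -
  have "countable (PiE {..<d} (\<lambda>_. \<rat> :: real set))"
    by (intro countable_PiE) (auto simp: countable_rat)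
  moreover have "{\<omega> \<in> space M. hits d (a \<omega>) (x \<omega>) (s \<omega>)} =
      (\<Union>c\<in>PiE {..<d} (\<lambda>_. \<rat>). {\<omega> \<in> space M. norm ((\<Sum>j<d. c j *\<^sub>R a \<omega> j) - x \<omega>) < s \<omega>})"
    by (auto simp: hits_iff_rational)
  moreover have "{\<omega> \<in> space M. norm ((\<Sum>j<d. c j *\<^sub>R a \<omega> j) - x \<omega>) < s \<omega>} \<in> sets M" for c
    using assms by measurable
  ultimately show ?thesis
    unfolding pred_def by (auto intro!: sets.countable_UN'')
qed

section \<open>Almost sure linear independence of Gaussian columns\<close>

lemma span_image_lessThan:
  fixes a :: "nat \<Rightarrow> 'a::real_vector"
  shows "v \<in> span (a ` {..<d}) \<longleftrightarrow> (\<exists>c. v = (\<Sum>j<d. c j *\<^sub>R a j))"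
proof (induction d arbitrary: v)
  case (Suc d)
  have "v \<in> span (a ` {..<Suc d}) \<longleftrightarrow> (\<exists>k c. v - k *\<^sub>R a d = (\<Sum>j<d. c j *\<^sub>R a j))"
    by (simp add: lessThan_Suc span_breakdown_eq Suc.IH)
  also have "\<dots> \<longleftrightarrow> (\<exists>c. v = (\<Sum>j<Suc d. c j *\<^sub>R a j))"
  proof
    assume "\<exists>k c. v - k *\<^sub>R a d = (\<Sum>j<d. c j *\<^sub>R a j)"
    then obtain k c where "v - k *\<^sub>R a d = (\<Sum>j<d. c j *\<^sub>R a j)" by blast
    then have "v = (\<Sum>j<Suc d. (c(d := k)) j *\<^sub>R a j)" by (simp add: algebra_simps)
    then show "\<exists>c. v = (\<Sum>j<Suc d. c j *\<^sub>R a j)" by blast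
  next
    assume "\<exists>c. v = (\<Sum>j<Suc d. c j *\<^sub>R a j)"
    then obtain c where "v = (\<Sum>j<Suc d. c j *\<^sub>R a j)" by blast
    then show "\<exists>k c. v - k *\<^sub>R a d = (\<Sum>j<d. c j *\<^sub>R a j)"
      by (intro exI[of _ "c d"] exI[of _ c]) simp
  qed
  finally show ?case .
qed simp

text \<open>A finite-dimensional span is closed, so membership amounts to approximation with every
  precision 1 / Suc n. This expresses it through countably many measurable conditions.\<close>

lemma mem_span_iff_hits:
  "x \<in> span (a ` {..<d}) \<longleftrightarrow> (\<forall>n. hits d a x (1 / real (Suc n)))"
proof
  assume "x \<in> span (a ` {..<d})"
  then obtain c where "x = (\<Sum>j<d. c j *\<^sub>R a j)" by (auto simp: span_image_lessThan)
  then show "\<forall>n. hits d a x (1 / real (Suc n))" by (auto simp: hits_def intro!: exI[of _ c])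
next
  assume h: "\<forall>n. hits d a x (1 / real (Suc n))"
  have "x \<in> closure (span (a ` {..<d}))"
    unfolding closure_approachable
  proof (intro allI impI)
    fix e :: real assume "e > 0"
    then obtain n where n: "1 / real (Suc n) < e" using nat_approx_posE by metis
    from h obtain c where "norm ((\<Sum>j<d. c j *\<^sub>R a j) - x) < 1 / real (Suc n)" by (auto simp: hits_def)
    with n show "\<exists>y\<in>span (a ` {..<d}). dist y x < e"
      by (intro bexI[of _ "\<Sum>j<d. c j *\<^sub>R a j"]) (auto simp: dist_norm span_image_lessThan)
  qed
  then show "x \<in> span (a ` {..<d})"
    using closed_subspace[of "span (a ` {..<d})"] by (simp add: closure_closed)
qed

lemma dim_image_lessThan:
  fixes a :: "nat \<Rightarrow> 'a::euclidean_space"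
  assumes "\<forall>i<d. a i \<notin> span (a ` {..<i})"
  shows "dim (a ` {..<d}) = d"
  using assms by (induction d) (auto simp: lessThan_Suc dim_insert)

text \<open>Each new column is independent of the previous ones, whose span has dimension below that
  of the space and is therefore a null set.\<close>

lemma AE_gauss_independent:
  assumes "d \<le> DIM('a::euclidean_space)"
  shows "AE a in PiM {..<d} (\<lambda>_. gauss :: 'a measure). dim (a ` {..<d}) = d"
proof -
  interpret P: product_sigma_finite "\<lambda>_::nat. gauss :: 'a measure"
    by (intro product_sigma_finite.intro) (rule gauss.sigma_finite_measure_axioms)
  define bad where "bad d = {a \<in> space (PiM {..<d} (\<lambda>_. gauss :: 'a measure)). \<exists>i<d. a i \<in> span (a ` {..<i})}" for d :: nat
  have meas: "bad d \<in> sets (PiM {..<d} (\<lambda>_. gauss))" for d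
  proof -
    have "{a \<in> space (PiM {..<d} (\<lambda>_. gauss :: 'a measure)). \<exists>i\<in>{..<d}. \<forall>n. hits i a (a i) (1 / real (Suc n))} \<in> sets (PiM {..<d} (\<lambda>_. gauss))"
      by measurable
    then show ?thesis by (simp add: bad_def mem_span_iff_hits Bex_def)
  qed
  have "emeasure (PiM {..<d} (\<lambda>_. gauss)) (bad d) = 0"
    using assms
  proof (induction d)
    case 0
    then show ?case by (simp add: bad_def)
  next
    case (Suc d)
    have span_null: "emeasure gauss (span (x ` {..<d})) = 0" for x :: "nat \<Rightarrow> 'a"
    proof -
      have "dim (span (x ` {..<d})) \<le> card (x ` {..<d})" by (simp add: dim_le_card')
      also have "\<dots> < DIM('a)" using card_image_le[of "{..<d}" x] Suc.prems by simp
      finally have "span (x ` {..<d}) \<in> null_sets gauss"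
        by (intro gauss_subspace_null subspace_span)
      then show ?thesis by (rule null_setsD1)
    qed
    have "emeasure (PiM {..<Suc d} (\<lambda>_. gauss)) (bad (Suc d)) = (\<integral>\<^sup>+a. indicator (bad (Suc d)) a \<partial>PiM (insert d {..<d}) (\<lambda>_. gauss))"
      using meas by (simp add: lessThan_Suc[symmetric])
    also have "\<dots> = (\<integral>\<^sup>+x. \<integral>\<^sup>+y. indicator (bad (Suc d)) (x(d := y)) \<partial>gauss \<partial>PiM {..<d} (\<lambda>_. gauss))"
      using meas[of "Suc d"] by (intro P.product_nn_integral_insert) (auto simp: lessThan_Suc)
    \<comment> \<open>Either the family was bad before the last column was added, or the last column
      lies in the span of the others.\<close>
    also have "\<dots> \<le> (\<integral>\<^sup>+x. \<integral>\<^sup>+y. indicator (bad d) x + indicator (span (x ` {..<d})) y \<partial>gauss \<partial>PiM {..<d} (\<lambda>_. gauss))"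
    proof (intro nn_integral_mono)
      fix x and y :: 'a assume x: "x \<in> space (PiM {..<d} (\<lambda>_. gauss :: 'a measure))"
      show "indicator (bad (Suc d)) (x(d := y)) \<le> (indicator (bad d) x + indicator (span (x ` {..<d})) y :: ennreal)"
      proof (cases "x(d := y) \<in> bad (Suc d)")
        case True
        then have "\<exists>i<Suc d. (x(d := y)) i \<in> span ((x(d := y)) ` {..<i})" unfolding bad_def by blast
        then obtain i where i: "i < Suc d" "(x(d := y)) i \<in> span ((x(d := y)) ` {..<i})" by blast
        \<comment> \<open>Since i <= d, the update at position \<open>d\<close> does not affect the
          columns before \<open>i\<close>.\<close>
        have im: "(x(d := y)) ` {..<i} = x ` {..<i}" using i(1) by (intro image_cong) auto
        then have "x \<in> bad d \<or> y \<in> span (x ` {..<d})"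
          using i(1) i(2)[unfolded im] x by (auto simp: bad_def less_Suc_eq split: if_splits)
        then show ?thesis by (auto simp: indicator_def)
      qed (simp add: indicator_def)
    qed
    also have "\<dots> = (\<integral>\<^sup>+x. indicator (bad d) x \<partial>PiM {..<d} (\<lambda>_. gauss))"
    proof (rule nn_integral_cong)
      fix x :: "nat \<Rightarrow> 'a"
      have [measurable]: "span (x ` {..<d}) \<in> sets borel"
        by (intro borel_closed closed_subspace subspace_span)
      show "(\<integral>\<^sup>+y. indicator (bad d) x + indicator (span (x ` {..<d})) y \<partial>gauss) = (indicator (bad d) x :: ennreal)"
        by (subst nn_integral_add) (simp_all add: span_null)
    qed
    also have "\<dots> = 0" using Suc meas by simp
    finally show ?case by simp
  qed
  then have "AE a in PiM {..<d} (\<lambda>_. gauss). a \<notin> bad d"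
    using meas by (intro AE_not_in) auto
  then show ?thesis
    using AE_space by eventually_elim (auto simp: bad_def intro!: dim_image_lessThan)
qed

section \<open>Independence of the hitting probability from the direction of the target\<close>

text \<open>The Householder reflection in the hyperplane orthogonal to x - y exchanges the two
  vectors.\<close>

lemma orthogonal_transformation_exists_euclidean:
  fixes x y :: "'a::euclidean_space"
  assumes "norm x = norm y"
  obtains T where "orthogonal_transformation T" "T x = y"
proof (cases "x = y")
  case True
  then show ?thesis using that[of "\<lambda>x. x"] by (simp add: orthogonal_transformation_def linear_ident)
next
  case False
  define w where "w = x - y"
  have ww: "w \<bullet> w \<noteq> 0" using False by (simp add: w_def)
  define T where "T z = z - (2 * (z \<bullet> w) / (w \<bullet> w)) *\<^sub>R w" for z
  have xy: "x \<bullet> x = y \<bullet> y" using assms by (simp add: norm_eq)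
  have "2 * (x \<bullet> w) = w \<bullet> w"
    using xy by (simp add: w_def inner_diff_left inner_diff_right inner_commute)
  then have "T x = y" using ww by (simp add: T_def w_def)
  moreover have "orthogonal_transformation T"
    unfolding orthogonal_transformation_def
  proof (intro conjI allI)
    show "linear T"
      by (rule linearI) (simp_all add: T_def inner_add_left algebra_simps add_divide_distrib)
    show "T v \<bullet> T z = v \<bullet> z" for v z
      using ww by (simp add: T_def inner_diff_left inner_diff_right inner_commute field_simps)
  qed
  ultimately show ?thesis by (rule that[rotated])
qed

abbreviation gauss_columns :: "nat \<Rightarrow> (nat \<Rightarrow> 'a::euclidean_space) measure" where
  "gauss_columns d \<equiv> PiM {..<d} (\<lambda>_. gauss)"

lemma prob_space_gauss_columns: "prob_space (gauss_columns d)"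
  by (intro prob_space_PiM prob_space_gauss)

lemma sets_hits_gauss_columns [measurable]:
  "{a \<in> space (gauss_columns d :: (nat \<Rightarrow> 'a::euclidean_space) measure). hits d a x s} \<in> sets (gauss_columns d)"
  by measurable

text \<open>Moving the target by \<open>T\<close> is compensated by moving all columns by
  \<open>T\<close>, and the joint law of the columns is invariant under that.\<close>

lemma emeasure_hits_orthogonal_transformation:
  fixes T :: "'a::euclidean_space \<Rightarrow> 'a"
  assumes T: "orthogonal_transformation T"
  shows "emeasure (gauss_columns d) {a \<in> space (gauss_columns d). hits d a (T x) s} =
    emeasure (gauss_columns d) {a \<in> space (gauss_columns d). hits d a x s}"
proof -
  have lin: "linear T" using T by (rule orthogonal_transformation_linear)
  have [measurable]: "T \<in> borel_measurable borel" using lin by (rule borel_measurable_linear)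
  have hits_T: "hits d (compose {..<d} T a) (T x) s \<longleftrightarrow> hits d a x s" for a
  proof -
    have "norm ((\<Sum>j<d. c j *\<^sub>R compose {..<d} T a j) - T x) = norm ((\<Sum>j<d. c j *\<^sub>R a j) - x)" for c
    proof -
      have "(\<Sum>j<d. c j *\<^sub>R compose {..<d} T a j) - T x = T ((\<Sum>j<d. c j *\<^sub>R a j) - x)"
        by (simp add: compose_def linear_diff[OF lin] linear_sum[OF lin] linear_scale[OF lin])
      then show ?thesis by (simp add: orthogonal_transformation_norm[OF T])
    qed
    then show ?thesis by (simp add: hits_def)
  qed
  have "distr gauss gauss T = (gauss :: 'a measure)"
    using distr_gauss_orthogonal_transformation[OF T] distr_cong[OF refl sets_gauss refl, of gauss T] by simp
  then have "distr (gauss_columns d) (gauss_columns d) (compose {..<d} T) = (gauss_columns d :: (nat \<Rightarrow> 'a) measure)"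
    using distr_PiM_finite_prob_space'[of "{..<d}" "\<lambda>_. gauss :: 'a measure" "\<lambda>_. gauss" T]
    by (simp add: prob_space_gauss)
  then have "emeasure (gauss_columns d) {a \<in> space (gauss_columns d). hits d a (T x) s} =
    emeasure (distr (gauss_columns d) (gauss_columns d) (compose {..<d} T)) {a \<in> space (gauss_columns d). hits d a (T x) s}"
    by simp
  also have "\<dots> = emeasure (gauss_columns d) {a \<in> space (gauss_columns d). hits d (compose {..<d} T a) (T x) s}"
  proof -
    have C: "compose {..<d} T \<in> measurable (gauss_columns d) (gauss_columns d)"
      unfolding compose_def by measurable
    have "compose {..<d} T -` {a \<in> space (gauss_columns d). hits d a (T x) s} \<inter> space (gauss_columns d) =
        {a \<in> space (gauss_columns d). hits d (compose {..<d} T a) (T x) s}"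
      using measurable_space[OF C] by blast
    then show ?thesis using emeasure_distr[OF C sets_hits_gauss_columns] by (simp only:)
  qed
  also have "\<dots> = emeasure (gauss_columns d) {a \<in> space (gauss_columns d). hits d a x s}"
    by (simp only: hits_T)
  finally show ?thesis .
qed

lemma hits_scale:
  assumes "k > 0"
  shows "hits d a (k *\<^sub>R x) (k * s) \<longleftrightarrow> hits d a x s"
proof -
  have imp: "hits d a (k *\<^sub>R x) (k * s)" if k: "k > 0" and h: "hits d a x s" for k x s
  proof -
    obtain c where "norm ((\<Sum>j<d. c j *\<^sub>R a j) - x) < s" using h by (auto simp: hits_def)
    moreover have "(\<Sum>j<d. (k * c j) *\<^sub>R a j) - k *\<^sub>R x = k *\<^sub>R ((\<Sum>j<d. c j *\<^sub>R a j) - x)"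
      by (simp add: scaleR_diff_right scaleR_sum_right)
    ultimately show ?thesis
      unfolding hits_def using k by (intro exI[of _ "\<lambda>j. k * c j"]) simp
  qed
  show ?thesis
  proof
    assume "hits d a (k *\<^sub>R x) (k * s)"
    from imp[OF _ this, of "1 / k"] assms show "hits d a x s" by simp
  qed (use imp assms in auto)
qed

text \<open>The cone condition is invariant under scaling, and orthogonal transformations act
  transitively on spheres. This constancy is what permits averaging over the target.\<close>

lemma emeasure_hits_cone_eq:
  fixes x y :: "'a::euclidean_space"
  assumes "x \<noteq> 0" "y \<noteq> 0"
  shows "emeasure (gauss_columns d) {a \<in> space (gauss_columns d). hits d a x (r * norm x)} =
    emeasure (gauss_columns d) {a \<in> space (gauss_columns d). hits d a y (r * norm y)}"
proof -
  define k where "k = norm y / norm x"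
  have k: "k > 0" using assms by (simp add: k_def)
  have "norm (k *\<^sub>R x) = norm y" using assms by (simp add: k_def)
  then obtain T where T: "orthogonal_transformation T" "T (k *\<^sub>R x) = y"
    by (rule orthogonal_transformation_exists_euclidean)
  have eq: "k * (r * norm x) = r * norm y" using assms by (simp add: k_def)
  have "hits d a x (r * norm x) \<longleftrightarrow> hits d a (k *\<^sub>R x) (r * norm y)" for a
    using hits_scale[OF k, of d a x "r * norm x"] unfolding eq by blast
  then show ?thesis
    using emeasure_hits_orthogonal_transformation[OF T(1), of d "k *\<^sub>R x" "r * norm y"] by (simp add: T(2))
qed

text \<open>Almost surely the columns span the space, so a single null set serves all targets and
  radii.\<close>

lemma AE_gauss_columns_hits:
  "AE a in gauss_columns DIM('a::euclidean_space). \<forall>(x::'a) s. s > 0 \<longrightarrow> hits DIM('a) a x s"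
  using AE_gauss_independent[OF order_refl, where 'a = 'a]
proof eventually_elim
  case (elim a)
  then have "span (a ` {..<DIM('a)}) = UNIV" by (simp add: dim_eq_full)
  then have "x \<in> span (a ` {..<DIM('a)})" for x by simp
  then have "\<exists>c. x = (\<Sum>j<DIM('a). c j *\<^sub>R a j)" for x
    unfolding span_image_lessThan .
  then show ?case by (metis hits_def norm_zero right_minus_eq)
qed

text \<open>Averaging over a Gaussian direction \<open>x\<close> instead of fixing it turns the random subspace
  into a fixed one.\<close>

lemma emeasure_hits_cone_ge_tau:
  fixes x :: "'a::euclidean_space"
  assumes d: "1 \<le> d" "d < DIM('a)" and r: "0 < r" "r < 1" and x: "x \<noteq> 0"
  shows "ennreal (tau r d DIM('a)) \<le> emeasure (gauss_columns d) {a \<in> space (gauss_columns d). hits d a x (r * norm x)}"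
    (is "_ \<le> ?Q")
proof -
  interpret C: prob_space "gauss_columns d :: (nat \<Rightarrow> 'a) measure" by (rule prob_space_gauss_columns)
  interpret pair_sigma_finite "gauss_columns d :: (nat \<Rightarrow> 'a) measure" "gauss :: 'a measure" ..
  have "ennreal (tau r d DIM('a)) = (\<integral>\<^sup>+a. ennreal (tau r d DIM('a)) \<partial>(gauss_columns d :: (nat \<Rightarrow> 'a) measure))"
    by (simp add: C.emeasure_space_1)
  also have "\<dots> \<le> (\<integral>\<^sup>+a. \<integral>\<^sup>+z. indicator {z. hits d a z (r * norm z)} z \<partial>(gauss :: 'a measure) \<partial>gauss_columns d)"
  proof (rule nn_integral_mono_AE)
    \<comment> \<open>The bound for a fixed subspace asks for dimension exactly \<open>d\<close>,
      which the span has for almost every \<open>a\<close>.\<close>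
    show "AE a in gauss_columns d. ennreal (tau r d DIM('a)) \<le> (\<integral>\<^sup>+z. indicator {z. hits d a z (r * norm z)} z \<partial>(gauss :: 'a measure))"
      using AE_gauss_independent[OF less_imp_le[OF d(2)]]
    proof eventually_elim
      case (elim a)
      have eq: "{z. hits d a z (r * norm z)} = {z. \<exists>v\<in>span (a ` {..<d}). norm (v - z) < r * norm z}"
        unfolding hits_def Bex_def span_image_lessThan by blast
      have "{z. hits d a z (r * norm z)} \<in> sets (gauss :: 'a measure)" by measurable
      then show ?case
        using gauss_cone_ge_tau[OF subspace_span _ d r, of "a ` {..<d}"] elim by (simp add: eq)
    qed
  qed
  also have "\<dots> = (\<integral>\<^sup>+z. \<integral>\<^sup>+a. indicator {z. hits d a z (r * norm z)} z \<partial>gauss_columns d \<partial>(gauss :: 'a measure))"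
    by (rule Fubini'[symmetric]) measurable
  also have "\<dots> = (\<integral>\<^sup>+z. emeasure (gauss_columns d) {a \<in> space (gauss_columns d). hits d a z (r * norm z)} \<partial>(gauss :: 'a measure))"
  proof (rule nn_integral_cong)
    fix z :: 'a
    have "(\<integral>\<^sup>+a. indicator {z. hits d a z (r * norm z)} z \<partial>gauss_columns d) =
        (\<integral>\<^sup>+a. indicator {a \<in> space (gauss_columns d). hits d a z (r * norm z)} a \<partial>gauss_columns d)"
      by (intro nn_integral_cong) (simp add: indicator_def)
    then show "(\<integral>\<^sup>+a. indicator {z. hits d a z (r * norm z)} z \<partial>gauss_columns d) =
        emeasure (gauss_columns d) {a \<in> space (gauss_columns d). hits d a z (r * norm z)}"
      by (subst (asm) nn_integral_indicator) auto
  qed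
  also have "\<dots> = (\<integral>\<^sup>+z. ?Q \<partial>(gauss :: 'a measure))"
  proof (rule nn_integral_cong_AE)
    \<comment> \<open>The probability is known to be constant in \<open>z\<close> away from
      0.\<close>
    have "{0} \<in> null_sets (gauss :: 'a measure)"
      using gauss_subspace_null[of "{0::'a}"] by (simp add: subspace_single_0)
    then have "AE z in gauss. z \<notin> {0::'a}" by (rule AE_not_in)
    then show "AE z in (gauss :: 'a measure). emeasure (gauss_columns d) {a \<in> space (gauss_columns d). hits d a z (r * norm z)} = ?Q"
      by eventually_elim (use x in \<open>auto intro: emeasure_hits_cone_eq\<close>)
  qed
  also have "\<dots> = ?Q" by simp
  finally show ?thesis .
qed

text \<open>A lower bound for a probability cannot exceed 1.\<close>

lemma tau_le_1:
  assumes "1 \<le> d" "d < DIM('a::euclidean_space)" "0 < r" "r < 1"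
  shows "tau r d DIM('a) \<le> 1"
proof -
  interpret C: prob_space "gauss_columns d :: (nat \<Rightarrow> 'a) measure" by (rule prob_space_gauss_columns)
  obtain x :: 'a where "x \<noteq> 0" using nonzero_Basis some_in_eq by blast
  have "ennreal (tau r d DIM('a)) \<le> 1"
    using emeasure_hits_cone_ge_tau[OF assms \<open>x \<noteq> 0\<close>] C.emeasure_le_1 order_trans by blast
  then show ?thesis by simp
qed

text \<open>As norm x <= R, the cone radius s / R * norm x is at most \<open>s\<close>. The target
  0, outside the cone estimate, is hit surely by zero coefficients, and there
  \<open>tau_le_1\<close> suffices.\<close>

lemma emeasure_hits_ge_tau:
  fixes x :: "'a::euclidean_space"
  assumes d: "1 \<le> d" "d < DIM('a)" and s: "0 < s" "s < R" and x: "norm x \<le> R"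
  shows "ennreal (tau (s / R) d DIM('a)) \<le> emeasure (gauss_columns d) {a \<in> space (gauss_columns d). hits d a x s}"
proof (cases "x = 0")
  case True
  interpret C: prob_space "gauss_columns d :: (nat \<Rightarrow> 'a) measure" by (rule prob_space_gauss_columns)
  have "hits d a x s" for a using s True by (auto simp: hits_def intro!: exI[of _ "\<lambda>_. 0"])
  then have "emeasure (gauss_columns d) {a \<in> space (gauss_columns d). hits d a x s} = 1"
    using C.emeasure_space_1 by simp
  then show ?thesis using tau_le_1[OF d, of "s / R"] s by simp
next
  case False
  have "s / R * norm x \<le> s"
    using s x by (simp add: field_simps)
  then have "hits d a x s" if "hits d a x (s / R * norm x)" for a
    using that by (auto simp: hits_def intro: less_le_trans)
  then have "emeasure (gauss_columns d) {a \<in> space (gauss_columns d). hits d a x (s / R * norm x)} \<le>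
      emeasure (gauss_columns d) {a \<in> space (gauss_columns d). hits d a x s}"
    by (intro emeasure_mono sets_hits_gauss_columns) auto
  then show ?thesis
    using emeasure_hits_cone_ge_tau[OF d _ _ False, of "s / R"] s by (auto intro: order_trans)
qed

text \<open>For d = 1 a continuous nonnegative integrand with vanishing integral would be 0 also at
  the midpoint, where the sine is positive. Positivity is the source of the strict inequality at
  \<open>kmax\<close>.\<close>

lemma tau_pos:
  assumes "0 < r" "r < 1" "1 \<le> d" "d < N"
  shows "0 < tau r d N"
proof (cases "d = 1")
  case True
  have r: "0 < arcsin r" "arcsin r < pi"
    using assms arcsin_less_arcsin[of 0 r] arcsin_bounded[of r] by (auto simp: field_simps)
  have N: "N \<ge> 2" using assms by simp
  have "real_binomial ((real N - 2) / 2) ((real N - 1) / 2) > 0"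
    unfolding real_binomial_def using N by (intro divide_pos_pos mult_pos_pos Gamma_real_pos) (auto simp: field_simps)
  moreover have "integral {0..arcsin r} (\<lambda>x. sin x ^ (N - 2)) > 0"
  proof (rule ccontr)
    have nonneg: "0 \<le> sin x ^ (N - 2)" if "x \<in> {0..arcsin r}" for x
      using r that by (intro zero_le_power sin_ge_zero) auto
    have cont: "continuous_on {0..arcsin r} (\<lambda>x. sin x ^ (N - 2))" by (intro continuous_intros)
    assume "\<not> ?thesis"
    moreover have "integral {0..arcsin r} (\<lambda>x. sin x ^ (N - 2)) \<ge> 0"
      using nonneg cont by (intro integral_nonneg integrable_continuous_real) auto
    ultimately have "\<forall>x\<in>{0..arcsin r}. sin x ^ (N - 2) = 0"
      using integral_eq_0_iff[OF cont r(1) nonneg] by simp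
    then have "sin (arcsin r / 2) ^ (N - 2) = 0" by (rule bspec) (use r in auto)
    moreover have "sin (arcsin r / 2) > 0" using r by (intro sin_gt_zero) auto
    ultimately show False by simp
  qed
  ultimately show ?thesis using True N by (simp add: tau_def)
next
  case False
  have "r\<^sup>2 < 1" using assms by (simp add: abs_square_less_1)
  moreover have "real_binomial ((real N - 2) / 2) ((real N - real d) / 2) > 0"
    unfolding real_binomial_def using assms False by (intro divide_pos_pos mult_pos_pos Gamma_real_pos) (auto simp: field_simps)
  ultimately show ?thesis using assms False by (simp add: tau_def)
qed

section \<open>The X-REGO process\<close>

lemma space_sigma_gen [simp]: "space (sigma_gen M Xs) = space M"
  unfolding sigma_gen_def by (rule space_measure_of) auto

lemma sets_sigma_gen:
  "sets (sigma_gen M Xs) = sigma_sets (space M) {X -` B \<inter> space M | X B. X \<in> Xs \<and> B \<in> sets borel}"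
  unfolding sigma_gen_def by (rule sets_measure_of) auto

lemma measurable_sigma_gen: "X \<in> Xs \<Longrightarrow> X \<in> borel_measurable (sigma_gen M Xs)"
  by (rule measurableI) (auto simp: sets_sigma_gen)

lemma sets_sigma_gen_mono: "Xs \<subseteq> Ys \<Longrightarrow> sets (sigma_gen M Xs) \<subseteq> sets (sigma_gen M Ys)"
  unfolding sets_sigma_gen by (rule sigma_sets_mono') auto

lemma sets_sigma_gen_subset:
  assumes "\<And>X. X \<in> Xs \<Longrightarrow> X \<in> borel_measurable M"
  shows "sets (sigma_gen M Xs) \<subseteq> sets M"
  unfolding sets_sigma_gen using assms by (intro sets.sigma_sets_subset) (auto dest: measurable_sets)

text \<open>A conditional probability of a non-measurable set has the junk value \<open>0\<close>, so that
  positivity implies measurability.\<close>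

lemma (in prob_space) sets_if_cond_exp_indicator_pos:
  assumes S: "S \<subseteq> space M" and pos: "AE x in M. 0 < real_cond_exp M F (indicator S) x"
  shows "S \<in> sets M"
proof (rule ccontr)
  assume "S \<notin> sets M"
  have "(\<lambda>x. ennreal (indicator S x)) \<notin> borel_measurable M"
  proof
    assume m: "(\<lambda>x. ennreal (indicator S x)) \<in> borel_measurable M"
    have "S = (\<lambda>x. ennreal (indicator S x)) -` {1} \<inter> space M"
      using S by (auto simp: indicator_def split: if_splits)
    also have "\<dots> \<in> sets M" using m by (rule measurable_sets) simp
    finally show False using \<open>S \<notin> sets M\<close> by simp
  qed
  then have "\<not> 0 < real_cond_exp M F (indicator S) x" for x
    by (simp add: real_cond_exp_def nn_cond_exp_def not_less)
  then show False using pos by simp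
qed

text \<open>Over an event of \<open>F\<close> the conditional expectation has the same integral as
  the indicator of \<open>S\<close>; the pointwise bound is integrated over
  \<open>G\<close>.\<close>

lemma (in prob_space) prob_Int_ge_if_cond_exp_ge:
  assumes F: "subalgebra M F" and S: "S \<subseteq> space M" and c: "0 < c"
    and ge: "AE x in M. c \<le> real_cond_exp M F (indicator S) x" and G: "G \<in> sets F"
  shows "c * prob G \<le> prob (G \<inter> S)"
proof -
  interpret finite_measure_subalgebra M F by standard (rule F)
  have [measurable]: "S \<in> sets M"
    using ge c by (intro sets_if_cond_exp_indicator_pos[OF S, of F]) (auto elim: eventually_mono)
  have [measurable]: "G \<in> sets M" using G F by (auto simp: subalgebra_def)
  have int: "integrable M (indicator S :: _ \<Rightarrow> real)" by (simp add: integrable_indicator_iff emeasure_eq_measure)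
  have "c * prob G = (\<integral>x. indicator G x * c \<partial>M)" by simp
  also have "\<dots> \<le> (\<integral>x. indicator G x * real_cond_exp M F (indicator S) x \<partial>M)"
  proof (rule integral_mono_AE)
    show "integrable M (\<lambda>x. indicator G x * real_cond_exp M F (indicator S) x)"
      using integrable_mult_indicator[OF \<open>G \<in> sets M\<close> real_cond_exp_int(1)[OF int]] by simp
    show "AE x in M. indicator G x * c \<le> indicator G x * real_cond_exp M F (indicator S) x"
      using ge by eventually_elim (auto simp: indicator_def)
  qed (simp add: integrable_indicator_iff emeasure_eq_measure)
  also have "\<dots> = (\<integral>x. indicator G x * indicator S x \<partial>M)"
    using real_cond_exp_intA[OF int G] by (simp add: set_lebesgue_integral_def)
  also have "\<dots> = prob (G \<inter> S)" by (simp add: indicator_inter_arith[symmetric])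
  finally show ?thesis .
qed

text \<open>A freezing argument in which the second variable is the sample point itself, seen
  through the \<sigma>-algebra \<open>T\<close>. By independence the pair has a product law, and a
  bound valid for each section over \<open>F\<close> integrates to a bound for the joint
  event.\<close>

lemma (in prob_space) prob_Int_ge_if_indep:
  assumes X: "X \<in> measurable M S" and T: "sets T \<subseteq> events" "space T = space M"
    and indep: "indep_set (sigma_sets (space M) {X -` A \<inter> space M | A. A \<in> sets S}) (sets T)"
    and F: "F \<in> sets T" and E: "E \<in> sets (S \<Otimes>\<^sub>M T)" and c: "0 \<le> c"
    and ge: "\<And>\<omega>. \<omega> \<in> F \<Longrightarrow> ennreal c \<le> emeasure (distr M S X) {a \<in> space S. (a, \<omega>) \<in> E}"
  shows "c * prob F \<le> prob {\<omega> \<in> F. (X \<omega>, \<omega>) \<in> E}"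
proof -
  have id: "(\<lambda>\<omega>. \<omega>) \<in> measurable M T"
    using T by (intro measurableI) (auto intro: subsetD sets.Int_space_eq2[THEN ssubst])
  have F_M: "F \<in> events" "F \<subseteq> space M" using F T sets.sets_into_space[of F T] by auto
  interpret A: prob_space "distr M S X" using X by (rule prob_space_distr)
  interpret B: prob_space "distr M T (\<lambda>\<omega>. \<omega>)" using id by (rule prob_space_distr)
  interpret pair_sigma_finite "distr M S X" "distr M T (\<lambda>\<omega>. \<omega>)" ..
  have XT: "(\<lambda>\<omega>. (X \<omega>, \<omega>)) \<in> measurable M (S \<Otimes>\<^sub>M T)" using X id by measurable
  have eq: "distr M S X \<Otimes>\<^sub>M distr M T (\<lambda>\<omega>. \<omega>) = distr M (S \<Otimes>\<^sub>M T) (\<lambda>\<omega>. (X \<omega>, \<omega>))"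
  proof (rule pair_measure_eqI)
    fix C D assume "C \<in> sets (distr M S X)" "D \<in> sets (distr M T (\<lambda>\<omega>. \<omega>))"
    then have CD: "C \<in> sets S" "D \<in> sets T" by auto
    then have D: "D \<subseteq> space M" "D \<in> events" using sets.sets_into_space[of D T] T by auto
    have "prob (X -` C \<inter> space M \<inter> D) = prob (X -` C \<inter> space M) * prob D"
      using CD by (intro indep_setD[OF indep] sigma_sets.Basic) auto
    moreover have "(\<lambda>\<omega>. (X \<omega>, \<omega>)) -` (C \<times> D) \<inter> space M = X -` C \<inter> space M \<inter> D"
      using D by auto
    ultimately show "emeasure (distr M S X) C * emeasure (distr M T (\<lambda>\<omega>. \<omega>)) D =
        emeasure (distr M (S \<Otimes>\<^sub>M T) (\<lambda>\<omega>. (X \<omega>, \<omega>))) (C \<times> D)"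
      using X id XT CD D
      by (simp add: emeasure_distr emeasure_eq_measure ennreal_mult Int_absorb2)
  qed (auto intro: A.sigma_finite_measure_axioms B.sigma_finite_measure_axioms cong: sets_pair_measure_cong)
  define E' where "E' = E \<inter> (space S \<times> F)"
  have E': "E' \<in> sets (S \<Otimes>\<^sub>M T)" using E F by (auto simp: E'_def)
  have "ennreal (c * prob F) = ennreal c * emeasure (distr M T (\<lambda>\<omega>. \<omega>)) F"
    using F F_M id c by (simp add: emeasure_distr emeasure_eq_measure ennreal_mult Int_absorb2)
  also have "\<dots> = (\<integral>\<^sup>+\<omega>. ennreal c * indicator F \<omega> \<partial>distr M T (\<lambda>\<omega>. \<omega>))"
    using F by (simp add: nn_integral_cmult_indicator)
  also have "\<dots> \<le> (\<integral>\<^sup>+\<omega>. emeasure (distr M S X) ((\<lambda>a. (a, \<omega>)) -` E') \<partial>distr M T (\<lambda>\<omega>. \<omega>))"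
  proof (rule nn_integral_mono)
    fix \<omega>
    have "(\<lambda>a. (a, \<omega>)) -` E' = {a \<in> space S. (a, \<omega>) \<in> E}" if "\<omega> \<in> F"
      using that by (auto simp: E'_def)
    then show "ennreal c * indicator F \<omega> \<le> emeasure (distr M S X) ((\<lambda>a. (a, \<omega>)) -` E')"
      using ge[of \<omega>] by (auto simp: indicator_def)
  qed
  also have "\<dots> = emeasure (distr M S X \<Otimes>\<^sub>M distr M T (\<lambda>\<omega>. \<omega>)) E'"
    using E' by (intro emeasure_pair_measure_alt2[symmetric]) (simp cong: sets_pair_measure_cong)
  also have "\<dots> = emeasure M {\<omega> \<in> F. (X \<omega>, \<omega>) \<in> E}"
  proof -
    have "(\<lambda>\<omega>. (X \<omega>, \<omega>)) -` E' \<inter> space M = {\<omega> \<in> F. (X \<omega>, \<omega>) \<in> E}"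
      using F_M measurable_space[OF X] by (auto simp: E'_def)
    then show ?thesis using emeasure_distr[OF XT E'] by (simp add: eq)
  qed
  finally show ?thesis by (simp add: emeasure_eq_measure)
qed

declare transpose_matrix_vector [simp del]

section \<open>Projected columns and measurability in the X-REGO process\<close>

context x_rego
begin

lemma A_measurable: "1 \<le> k \<Longrightarrow> j < emb_dim dlb k \<Longrightarrow> (\<lambda>\<omega>. A k \<omega> i j) \<in> borel_measurable M"
  using distributed_measurable[OF A_normal[of k j i]] by simp

lemma p_component_measurable: "(\<lambda>\<omega>. p k \<omega> $ i) \<in> borel_measurable M"
  using p_rv[of k] by (simp add: borel_measurable_euclidean_space[of "p k"] Basis_vec_def inner_axis[symmetric] cart_eq_inner_axis)

text \<open>The entries of one column form a Gaussian vector, and the transpose of \<open>U\<close>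
  is the adjoint of an isometry, so its image is Gaussian in the effective space. Grouping entries
  by columns keeps independence. The number \<open>d\<close> may be smaller than the dimension of
  the embedding.\<close>

lemma distr_columns:
  fixes U :: "real^'e^'n"
  assumes k: "1 \<le> k" and d: "1 \<le> d" "d \<le> emb_dim dlb k" and U: "transpose U ** U = mat 1"
  shows "(\<lambda>\<omega>. \<lambda>j\<in>{..<d}. transpose U *v (\<chi> i. A k \<omega> i j)) \<in> measurable M (gauss_columns d)" (is "?X \<in> _")
    and "distr M (gauss_columns d) (\<lambda>\<omega>. \<lambda>j\<in>{..<d}. transpose U *v (\<chi> i. A k \<omega> i j)) = gauss_columns d"
proof -
  let ?u = "\<lambda>x. transpose U *v x"
  let ?A = "\<lambda>(i, j) \<omega>. A k \<omega> i j"
  have u_lin: "linear ?u" by (rule matrix_vector_mul_linear)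
  have [measurable]: "?u \<in> borel_measurable borel" using u_lin by (rule borel_measurable_linear)
  have A_meas: "(\<lambda>\<omega>. A k \<omega> i j) \<in> borel_measurable M" if "j < d" for i j
    using that d k by (intro A_measurable) auto
  have col: "distr M borel (\<lambda>\<omega>. ?u (\<chi> i. A k \<omega> i j)) = gauss" if j: "j < d" for j
  proof -
    have normal: "distr M borel (\<lambda>\<omega>. A k \<omega> i j) = std_normal" for i
      using distributed_distr_eq_density[OF A_normal[OF k, of j i]] distr_cong[OF refl sets_lborel refl, of M "\<lambda>\<omega>. A k \<omega> i j"] j d
      by simp
    have "indep_vars (\<lambda>_. borel) ?A (UNIV \<times> {j})"
      using A_indep[OF k] by (rule indep_vars_subset) (use j d in auto)
    then have "distr M (PiM (UNIV \<times> {j}) (\<lambda>_. borel)) (\<lambda>\<omega>. \<lambda>q\<in>UNIV \<times> {j}. ?A q \<omega>) = PiM (UNIV \<times> {j}) (\<lambda>q. distr M borel (?A q))"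
      using A_meas[OF j] by (subst (asm) indep_vars_iff_distr_eq_PiM') auto
    also have "\<dots> = PiM (UNIV \<times> {j}) (\<lambda>_. std_normal)"
      using normal by (intro PiM_cong) auto
    finally have row: "PiM (UNIV \<times> {j}) (\<lambda>_. std_normal) =
        distr M (PiM (UNIV \<times> {j}) (\<lambda>_. borel)) (\<lambda>\<omega>. \<lambda>q\<in>UNIV \<times> {j}. ?A q \<omega>)" ..
    have restr: "(\<lambda>f. \<lambda>i\<in>UNIV. f (i, j)) \<in> measurable (PiM (UNIV \<times> {j}) (\<lambda>_. std_normal)) (PiM (UNIV :: 'n set) (\<lambda>_. std_normal))"
      by (rule measurable_restrict) auto
    have "(gauss :: (real^'n) measure) = distr (PiM UNIV (\<lambda>_. std_normal)) borel (\<lambda>f. \<chi> i. f i)"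
      by (rule gauss_eq_distr_cart)
    also have "PiM (UNIV :: 'n set) (\<lambda>_. std_normal) = distr (PiM (UNIV \<times> {j}) (\<lambda>_. std_normal)) (PiM UNIV (\<lambda>_. std_normal)) (\<lambda>f. \<lambda>i\<in>UNIV. f (i, j))"
      by (rule distr_PiM_reindex[symmetric]) (auto simp: prob_space_std_normal inj_on_def)
    also have "distr \<dots> borel (\<lambda>f. \<chi> i. f i) = distr (PiM (UNIV \<times> {j}) (\<lambda>_. std_normal)) borel (\<lambda>f. \<chi> i. f (i, j))"
      using restr by (subst distr_distr) (auto simp: comp_def vec_eq_iff intro!: distr_cong)
    also have "\<dots> = distr M borel (\<lambda>\<omega>. \<chi> i. A k \<omega> i j)"
    proof -
      have "(\<lambda>\<omega>. \<lambda>q\<in>UNIV \<times> {j}. ?A q \<omega>) \<in> measurable M (PiM (UNIV \<times> {j}) (\<lambda>_. borel))"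
        using A_meas[OF j] by (intro measurable_restrict) auto
      then show ?thesis
        unfolding row by (subst distr_distr) (auto simp: comp_def)
    qed
    finally have col_gauss: "distr M borel (\<lambda>\<omega>. \<chi> i. A k \<omega> i j) = gauss" ..
    have "distr M borel (\<lambda>\<omega>. ?u (\<chi> i. A k \<omega> i j)) = distr (distr M borel (\<lambda>\<omega>. \<chi> i. A k \<omega> i j)) borel ?u"
      using A_meas[OF j] by (subst distr_distr) (auto simp: comp_def)
    also have "\<dots> = gauss"
      unfolding col_gauss
    proof (rule distr_gauss_isometry_adjoint[OF u_lin])
      show "?u x \<bullet> z = x \<bullet> (U *v z)" for x z
        by (simp add: dot_lmul_matrix transpose_matrix_vector)
      show "(U *v z) \<bullet> (U *v w) = z \<bullet> w" for z w
        by (metis U dot_lmul_matrix matrix_vector_mul_assoc matrix_vector_mul_lid transpose_matrix_vector inner_commute)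
    qed
    finally show ?thesis .
  qed
  have "indep_vars (\<lambda>_. borel) ?A (UNIV \<times> {..<d})"
    using A_indep[OF k] by (rule indep_vars_subset) (use d in auto)
  then have "indep_vars (\<lambda>j. PiM (UNIV \<times> {j}) (\<lambda>_. borel)) (\<lambda>j \<omega>. restrict (\<lambda>q. ?A q \<omega>) (UNIV \<times> {j})) {..<d}"
    by (rule indep_vars_restrict) (auto simp: disjoint_family_on_def)
  then have "indep_vars (\<lambda>_. borel) (\<lambda>j \<omega>. ?u (\<chi> i. restrict (\<lambda>q. ?A q \<omega>) (UNIV \<times> {j}) (i, j))) {..<d}"
    by (rule indep_vars_compose2[where Y = "\<lambda>j f. ?u (\<chi> i. f (i, j))"]) auto
  then have "indep_vars (\<lambda>_. borel) (\<lambda>j \<omega>. ?u (\<chi> i. A k \<omega> i j)) {..<d}"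
    by simp
  then have "distr M (PiM {..<d} (\<lambda>_. borel)) ?X = PiM {..<d} (\<lambda>j. distr M borel (\<lambda>\<omega>. ?u (\<chi> i. A k \<omega> i j)))"
    using A_meas d by (subst (asm) indep_vars_iff_distr_eq_PiM') (auto simp: lessThan_empty_iff)
  also have "\<dots> = gauss_columns d" by (rule PiM_cong) (auto simp: col)
  also have "distr M (PiM {..<d} (\<lambda>_. borel)) ?X = distr M (gauss_columns d) ?X"
    by (intro distr_cong sets_PiM_cong) auto
  finally show "distr M (gauss_columns d) ?X = gauss_columns d" .
  show "?X \<in> measurable M (gauss_columns d)"
    using A_meas by measurable
qed

text \<open>The projected columns are functions of the entries of \<open>A k\<close>, hence generate
  a part of the \<sigma>-algebra that is independent of the past.\<close>

lemma indep_columns_past: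
  fixes U :: "real^'e^'n"
  assumes k: "1 \<le> k" and d: "d \<le> emb_dim dlb k"
  defines "X \<equiv> \<lambda>\<omega>. \<lambda>j\<in>{..<d}. transpose U *v (\<chi> i. A k \<omega> i j)"
  shows "indep_set (sigma_sets (space M) {X -` B \<inter> space M | B. B \<in> sets (gauss_columns d)}) (sets (past M dlb A y p (k - 1)))"
proof -
  let ?S = "sigma_gen M (entries_A dlb A k)"
  have [measurable]: "(\<lambda>x. transpose U *v x) \<in> borel_measurable borel"
    by (intro borel_measurable_linear matrix_vector_mul_linear)
  have [measurable]: "(\<lambda>\<omega>. A k \<omega> i j) \<in> borel_measurable ?S" if "j < d" for i j
    using that d unfolding entries_A_def by (intro measurable_sigma_gen CollectI exI[of _ i] exI[of _ j]) auto
  have X: "X \<in> measurable ?S (gauss_columns d)"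
    unfolding X_def by measurable
  have "{X -` B \<inter> space M | B. B \<in> sets (gauss_columns d)} \<subseteq> sets ?S"
    using measurable_sets[OF X] by auto
  from sets.sigma_sets_subset[OF this]
  have "sigma_sets (space M) {X -` B \<inter> space M | B. B \<in> sets (gauss_columns d)} \<subseteq> sets ?S"
    by (simp only: space_sigma_gen)
  then show ?thesis
    using A_indep_past[OF k] unfolding indep_set_def
    by (elim indep_sets_mono_sets) (auto split: bool.split)
qed

lemma sets_past_subset: "sets (past M dlb A y p k) \<subseteq> events"
  unfolding past_def
  by (intro sets_sigma_gen_subset)
    (auto simp: entries_A_def entries_y_def entries_p_def intro: A_measurable y_rv p_component_measurable)

lemma space_past [simp]: "space (past M dlb A y p k) = space M"
  by (simp add: past_def)

lemma subalgebra_half_past: "subalgebra M (half_past M dlb A y p k)"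
  unfolding subalgebra_def half_past_def
  by (intro conjI sets_sigma_gen_subset)
    (auto simp: entries_A_def entries_y_def entries_p_def intro: A_measurable y_rv p_component_measurable)

text \<open>For k >= 1 the index ranges up to k - 1 and below \<open>k\<close> agree; the half step
  adds only the entries of the new matrix.\<close>

lemma sets_past_subset_half_past:
  "1 \<le> k \<Longrightarrow> sets (past M dlb A y p (k - 1)) \<subseteq> sets (half_past M dlb A y p k)"
  unfolding past_def half_past_def by (intro sets_sigma_gen_mono) (cases k; fastforce)

lemma past_mono: "l \<le> k \<Longrightarrow> sets (past M dlb A y p l) \<subseteq> sets (past M dlb A y p k)"
  unfolding past_def by (intro sets_sigma_gen_mono) fastforce

lemma iterate_measurable_past:
  assumes "1 \<le> k"
  shows "iterate dlb A y p k \<in> borel_measurable (past M dlb A y p k)"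
proof -
  have [measurable]: "(\<lambda>\<omega>. A k \<omega> i j) \<in> borel_measurable (past M dlb A y p k)"
      "(\<lambda>\<omega>. y k \<omega> j) \<in> borel_measurable (past M dlb A y p k)" if "j < emb_dim dlb k" for i j
    unfolding past_def using that assms
    by (auto intro!: measurable_sigma_gen simp: entries_A_def entries_y_def)
  have [measurable]: "(\<lambda>\<omega>. p (k - 1) \<omega> $ i) \<in> borel_measurable (past M dlb A y p k)" for i
    unfolding past_def using assms by (intro measurable_sigma_gen) (auto simp: entries_p_def)
  have eq: "iterate dlb A y p k = (\<lambda>\<omega>. \<chi> i. (\<Sum>j<emb_dim dlb k. A k \<omega> i j * y k \<omega> j) + p (k - 1) \<omega> $ i)"
    by (auto simp: iterate_def mat_vec_def vec_eq_iff)
  show ?thesis unfolding eq by measurable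
qed

lemma p_measurable_past: "p k \<in> borel_measurable (past M dlb A y p k)"
proof -
  have "(\<lambda>\<omega>. p k \<omega> $ i) \<in> borel_measurable (past M dlb A y p k)" for i
    unfolding past_def by (intro measurable_sigma_gen) (auto simp: entries_p_def)
  then have "(\<lambda>\<omega>. \<chi> i. p k \<omega> $ i) \<in> borel_measurable (past M dlb A y p k)" by measurable
  then show ?thesis by simp
qed

end

section \<open>Reduction to the effective coordinates and the success probabilities\<close>

text \<open>The residual of \<open>x\<close> after projection to the column space is orthogonal to
  all columns, so \<open>f\<close> does not see it.\<close>

lemma constant_off_columns:
  fixes U :: "real^'e^'n"
  assumes "constant_off f (span (columns U))" and U: "transpose U ** U = mat 1"
  shows "f x = f (U *v (transpose U *v x))"
proof -
  define v where "v = x - U *v (transpose U *v x)"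
  have "transpose U *v v = 0"
    unfolding v_def matrix_vector_mult_diff_distrib matrix_vector_mul_assoc matrix_mul_assoc U by simp
  then have col: "orthogonal v (column i U)" for i
    by (simp add: orthogonal_def matrix_vector_mult_basis[symmetric] dot_lmul_matrix[symmetric] transpose_matrix_vector[symmetric])
  have "orthogonal v w" if "w \<in> span (columns U)" for w
    using that by (rule orthogonal_to_span) (use col in \<open>auto simp: columns_def\<close>)
  then have "v \<in> orthogonal_comp (span (columns U))"
    by (auto simp: orthogonal_comp_def orthogonal_commute)
  moreover have "U *v (transpose U *v x) \<in> span (columns U)"
    by (rule matrix_vector_mult_in_columnspace)
  ultimately have "f (U *v (transpose U *v x) + v) = f (U *v (transpose U *v x))"
    using assms(1) unfolding constant_off_def by blast
  then show ?thesis by (simp add: v_def)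
qed

text \<open>Strictness at \<open>kmax\<close> is asserted when an earlier iterate exists and
  \<open>\<rho> kmax\<close> is below 1: no probability exceeds 1, and for kmax = 1 the only iterate
  is the one whose solver bound is \<open>\<rho> kmax\<close> itself.\<close>

theorem corollary7p7:
  fixes f :: "real^'n::finite \<Rightarrow> real"
    and U :: "real^'e::finite^'n"
    and M :: "'w measure"
    and A :: "nat \<Rightarrow> 'w \<Rightarrow> 'n \<Rightarrow> nat \<Rightarrow> real"
    and y :: "nat \<Rightarrow> 'w \<Rightarrow> nat \<Rightarrow> real"
    and p :: "nat \<Rightarrow> 'w \<Rightarrow> real^'n"
    and xopt :: "nat \<Rightarrow> 'w \<Rightarrow> real^'n"
    and xstar :: "real^'n"
    and \<rho> :: "nat \<Rightarrow> real"
    and dlb kmax :: nat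
    and \<epsilon> lam L \<rho>lb Rmax :: real
  assumes process: "x_rego M dlb A y p"
    and xopt: "\<And>k \<omega>. 1 \<le> k \<Longrightarrow> \<omega> \<in> space M \<Longrightarrow>
          is_arg_min f (\<lambda>x. x \<in> (\<lambda>i. iterate dlb A y p i \<omega>) ` {1..k}) (xopt k \<omega>)"
    and tolerance: "0 < lam" "lam < \<epsilon>"
    and lipschitz: "0 < L" "L-lipschitz_on UNIV f"
    and \<rho>lb: "0 < \<rho>lb"
    and \<rho>: "\<And>k. 1 \<le> k \<Longrightarrow> \<rho> k \<in> {\<rho>lb..1}"
    and solver: "\<And>k. 1 \<le> k \<Longrightarrow>
          (AE \<omega> in M. real_cond_exp M (half_past M dlb A y p k)
             (indicator {\<omega> \<in> space M. solver_success f lam dlb A y p k \<omega> = 1}) \<omega> \<ge> \<rho> k)"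
    and U_orthonormal: "transpose U ** U = mat 1"
    and eff_dim: "has_effective_dim f CARD('e) (span (columns U))"
    and minimizer: "is_arg_min f (\<lambda>_. True) xstar"
    and Rmax: "(\<epsilon> - lam) / L < Rmax"
    and near: "\<And>k \<omega>. \<omega> \<in> space M \<Longrightarrow>
          norm (transpose U *v p k \<omega> - transpose U *v xstar) \<le> Rmax"
    and dlb: "1 \<le> dlb" "dlb \<le> CARD('e)"
    and kmax: "kmax = CARD('e) - dlb + 1"
  shows
    "measure M {\<omega> \<in> space M. f (xopt kmax \<omega>) \<le> (INF x. f x) + \<epsilon>} \<ge> \<rho> kmax \<and>
     (1 < kmax \<and> \<rho> kmax < 1 \<longrightarrow>
       measure M {\<omega> \<in> space M. f (xopt kmax \<omega>) \<le> (INF x. f x) + \<epsilon>} > \<rho> kmax) \<and>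
     ((AE \<omega> in M. f (iterate dlb A y p kmax \<omega>) = reduced_min_at f dlb A p kmax \<omega>) \<longrightarrow>
       measure M {\<omega> \<in> space M. f (xopt kmax \<omega>) \<le> (INF x. f x) + \<epsilon>} = 1) \<and>
     (\<forall>k. 1 \<le> k \<and> k < kmax \<longrightarrow>
       measure M {\<omega> \<in> space M. f (xopt k \<omega>) \<le> (INF x. f x) + \<epsilon>}
         \<ge> 1 - (1 - \<rho>lb * tau ((\<epsilon> - lam) / (L * Rmax)) dlb CARD('e)) ^ k)"
proof -
  interpret x_rego M dlb A y p by (rule process)
  let ?u = "\<lambda>x. transpose U *v x"
  define s where "s = (\<epsilon> - lam) / L"
  define fs where "fs = f xstar"
  define \<tau> where "\<tau> = tau ((\<epsilon> - lam) / (L * Rmax)) dlb CARD('e)"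
  define X where "X d k = (\<lambda>\<omega>. \<lambda>j\<in>{..<d}. ?u (\<chi> i. A k \<omega> i j))" for d k
  \<comment> \<open>The target that the columns have to approach in effective coordinates; step
    \<open>k\<close> starts from p (k - 1).\<close>
  define z where "z k \<omega> = ?u (xstar - p (k - 1) \<omega>)" for k \<omega>
  define good where "good d k \<omega> \<longleftrightarrow> hits d (X d k \<omega>) (z k \<omega>) s" for d k \<omega>
  define succ where "succ k \<omega> \<longleftrightarrow> f (iterate dlb A y p k \<omega>) \<le> fs + \<epsilon>" for k \<omega>
  \<comment> \<open>\<open>fail 0\<close> is the whole space, which starts the recursion.\<close>
  define fail where "fail k = {\<omega> \<in> space M. \<forall>i\<in>{1..k}. \<not> succ i \<omega>}" for k
  define S where "S k = {\<omega> \<in> space M. solver_success f lam dlb A y p k \<omega> = 1}" for k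
  have u_lin: "linear ?u" by (rule matrix_vector_mul_linear)
  have u_meas [measurable]: "?u \<in> borel_measurable borel" using u_lin by (rule borel_measurable_linear)
  have s: "0 < s" "s < Rmax" using tolerance lipschitz(1) Rmax by (auto simp: s_def)
  have fs_le: "fs \<le> f x" for x
    using minimizer by (auto simp: is_arg_min_def fs_def not_less)
  have inf_f: "(INF x. f x) = fs"
    by (rule cInf_eq_minimum) (auto simp: fs_def[symmetric] fs_le, simp add: fs_def)
  have bdd: "bdd_below (range (\<lambda>y. f (g y)))" for g :: "(nat \<Rightarrow> real) \<Rightarrow> _"
    using fs_le by (intro bdd_belowI[of _ fs]) auto
  have f_meas: "f \<in> borel_measurable borel"
    using lipschitz(2) by (intro borel_measurable_continuous_onI lipschitz_on_continuous_on)
  have iso: "norm (U *v w) = norm w" for w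
    by (metis U_orthonormal dot_lmul_matrix matrix_vector_mul_assoc matrix_vector_mul_lid norm_eq transpose_matrix_vector)
  have const: "f x = f (U *v ?u x)" for x
    using eff_dim U_orthonormal by (intro constant_off_columns) (auto simp: has_effective_dim_def)
  \<comment> \<open>Replacing \<open>x\<close> by \<open>U *v ?u x\<close> keeps the value of
    \<open>f\<close>, and \<open>U\<close> is isometric, so only the effective coordinates enter the
    Lipschitz bound.\<close>
  have lip: "f x \<le> f x' + L * norm (?u x - ?u x')" for x x'
  proof -
    have "f x - f x' \<le> \<bar>f (U *v ?u x) - f (U *v ?u x')\<bar>"
      using const[of x] const[of x'] by simp
    also have "\<dots> \<le> L * norm (U *v ?u x - U *v ?u x')"
      using lipschitz_onD[OF lipschitz(2), of "U *v ?u x" "U *v ?u x'"] by (simp add: dist_norm dist_real_def)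
    also have "U *v ?u x - U *v ?u x' = U *v (?u x - ?u x')"
      by (simp add: matrix_vector_mult_diff_distrib)
    finally show ?thesis by (simp add: iso)
  qed
  have z_norm: "norm (z k \<omega>) \<le> Rmax" if "\<omega> \<in> space M" for k \<omega>
    using near[OF that, of "k - 1"] by (simp add: z_def matrix_vector_mult_diff_distrib norm_minus_commute)
  have good_min: "reduced_min_at f dlb A p k \<omega> \<le> fs + (\<epsilon> - lam)"
    if g: "good d k \<omega>" and d: "d \<le> emb_dim dlb k" for d k \<omega>
  proof -
    obtain c where c: "norm ((\<Sum>j<d. c j *\<^sub>R X d k \<omega> j) - z k \<omega>) < s"
      using g by (auto simp: good_def hits_def)
    \<comment> \<open>Columns from \<open>d\<close> on get coefficient 0, so the first
      \<open>d\<close> columns suffice within a larger embedding.\<close>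
    define y' where "y' j = (if j < d then c j else 0)" for j
    let ?x = "mat_vec (emb_dim dlb k) (A k \<omega>) y' + p (k - 1) \<omega>"
    have "mat_vec (emb_dim dlb k) (A k \<omega>) y' = (\<Sum>j<d. c j *\<^sub>R (\<chi> i. A k \<omega> i j))"
    proof -
      have "(\<Sum>j<emb_dim dlb k. A k \<omega> i j * y' j) = (\<Sum>j<d. A k \<omega> i j * y' j)" for i
        using d by (intro sum.mono_neutral_right) (auto simp: y'_def)
      also have "(\<Sum>j<d. A k \<omega> i j * y' j) = (\<Sum>j<d. c j * A k \<omega> i j)" for i
        by (intro sum.cong) (auto simp: y'_def)
      finally show ?thesis by (simp add: mat_vec_def vec_eq_iff)
    qed
    then have "?u (mat_vec (emb_dim dlb k) (A k \<omega>) y') = (\<Sum>j<d. c j *\<^sub>R X d k \<omega> j)"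
      by (simp add: X_def linear_sum[OF u_lin] linear_scale[OF u_lin])
    then have "?u ?x - ?u xstar = (\<Sum>j<d. c j *\<^sub>R X d k \<omega> j) - z k \<omega>"
      by (simp add: z_def matrix_vector_right_distrib matrix_vector_mult_diff_distrib)
    then have "norm (?u ?x - ?u xstar) \<le> s" using c by simp
    then have "L * norm (?u ?x - ?u xstar) \<le> L * s" using lipschitz(1) by simp
    then have "f ?x \<le> fs + (\<epsilon> - lam)"
      using lip[of ?x xstar] lipschitz(1) by (simp add: fs_def s_def)
    moreover have "reduced_min_at f dlb A p k \<omega> \<le> f ?x"
      unfolding reduced_min_at_def reduced_min_def by (intro cINF_lower bdd) simp
    ultimately show ?thesis by simp
  qed
  \<comment> \<open>The tolerance \<open>lam\<close> of the solver and the error \<epsilon> - lam of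
    the embedding add up to \<epsilon>.\<close>
  have good_S: "succ k \<omega>" if "good d k \<omega>" "d \<le> emb_dim dlb k" "\<omega> \<in> S k" for d k \<omega>
    using good_min[OF that(1,2)] that(3) by (auto simp: S_def solver_success_def succ_def)
  have succ_sets: "{\<omega> \<in> space M. succ k \<omega>} \<in> sets (past M dlb A y p k)" if "1 \<le> k" for k
  proof -
    have [measurable]: "(\<lambda>\<omega>. f (iterate dlb A y p k \<omega>)) \<in> borel_measurable (past M dlb A y p k)"
      using iterate_measurable_past[OF that] f_meas by (rule measurable_compose)
    have "{\<omega> \<in> space (past M dlb A y p k). f (iterate dlb A y p k \<omega>) \<le> fs + \<epsilon>} \<in> sets (past M dlb A y p k)"
      by measurable
    then show ?thesis by (simp add: succ_def)
  qed
  have fail_sets: "fail k \<in> sets (past M dlb A y p k)" for k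
  proof -
    have "fail k = space (past M dlb A y p k) - (\<Union>i\<in>{1..k}. {\<omega> \<in> space M. succ i \<omega>})"
      by (auto simp: fail_def)
    also have "\<dots> \<in> sets (past M dlb A y p k)"
      using succ_sets past_mono by (intro sets.Diff sets.top sets.finite_UN) fastforce+
    finally show ?thesis .
  qed
  have fail_events: "fail k \<in> events" for k using fail_sets sets_past_subset by blast
  have prob_opt: "prob {\<omega> \<in> space M. f (xopt k \<omega>) \<le> (INF x. f x) + \<epsilon>} = 1 - prob (fail k)" if k: "1 \<le> k" for k
  proof -
    have "f (xopt k \<omega>) \<le> fs + \<epsilon> \<longleftrightarrow> (\<exists>i\<in>{1..k}. succ i \<omega>)" if "\<omega> \<in> space M" for \<omega>
    proof -
      from xopt[OF k that] obtain i where "i \<in> {1..k}" "xopt k \<omega> = iterate dlb A y p i \<omega>"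
        and "\<And>i. i \<in> {1..k} \<Longrightarrow> f (xopt k \<omega>) \<le> f (iterate dlb A y p i \<omega>)"
        by (auto simp: is_arg_min_def not_less)
      then show ?thesis unfolding succ_def by (metis order_trans)
    qed
    then have "{\<omega> \<in> space M. f (xopt k \<omega>) \<le> (INF x. f x) + \<epsilon>} = space M - fail k"
      by (auto simp: inf_f fail_def)
    then show ?thesis using prob_compl[OF fail_events] by simp
  qed
  \<comment> \<open>The bound \<open>c\<close> is uniform in the target because the target is random
    through the past. Membership in \<open>half_past\<close> lets the solver hypothesis be applied
    on this event.\<close>
  have good_prob: "{\<omega> \<in> F. good d k \<omega>} \<in> events" "c * prob F \<le> prob {\<omega> \<in> F. good d k \<omega>}"
      "{\<omega> \<in> F. good d k \<omega>} \<in> sets (half_past M dlb A y p k)"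
    if k: "1 \<le> k" and d: "1 \<le> d" "d \<le> emb_dim dlb k" and F: "F \<in> sets (past M dlb A y p (k - 1))" and c: "0 \<le> c"
      and ge: "\<And>w :: real^'e. norm w \<le> Rmax \<Longrightarrow> ennreal c \<le> emeasure (gauss_columns d) {a \<in> space (gauss_columns d). hits d a w s}"
    for k d c F
  proof -
    let ?P = "past M dlb A y p (k - 1)"
    have F_M: "F \<subseteq> space M" using sets.sets_into_space[OF F] by simp
    have X: "X d k \<in> measurable M (gauss_columns d)" "distr M (gauss_columns d) (X d k) = gauss_columns d"
      unfolding X_def by (rule distr_columns[OF k d U_orthonormal])+
    have z_meas [measurable]: "z k \<in> borel_measurable ?P"
      using p_measurable_past[of "k - 1"] unfolding z_def by measurable
    define E where "E = {q \<in> space (gauss_columns d \<Otimes>\<^sub>M ?P). hits d (fst q) (z k (snd q)) s}"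
    have E: "E \<in> sets (gauss_columns d \<Otimes>\<^sub>M ?P)"
      unfolding E_def by measurable
    have "c * prob F \<le> prob {\<omega> \<in> F. (X d k \<omega>, \<omega>) \<in> E}"
    proof (rule prob_Int_ge_if_indep[OF X(1) sets_past_subset space_past _ F E c])
      show "indep_set (sigma_sets (space M) {X d k -` B \<inter> space M | B. B \<in> sets (gauss_columns d)}) (sets ?P)"
        unfolding X_def by (rule indep_columns_past[OF k d(2)])
      fix \<omega> assume "\<omega> \<in> F"
      then have \<omega>: "\<omega> \<in> space M" using F_M by auto
      then have "{a \<in> space (gauss_columns d). (a, \<omega>) \<in> E} = {a \<in> space (gauss_columns d). hits d a (z k \<omega>) s}"
        by (auto simp: E_def space_pair_measure)
      then show "ennreal c \<le> emeasure (distr M (gauss_columns d) (X d k)) {a \<in> space (gauss_columns d). (a, \<omega>) \<in> E}"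
        using ge[OF z_norm[OF \<omega>]] by (simp add: X(2))
    qed
    moreover have "{\<omega> \<in> F. (X d k \<omega>, \<omega>) \<in> E} = {\<omega> \<in> F. good d k \<omega>}"
      using F_M measurable_space[OF X(1)] by (auto simp: E_def good_def space_pair_measure)
    ultimately show "c * prob F \<le> prob {\<omega> \<in> F. good d k \<omega>}" by simp
    let ?H = "half_past M dlb A y p k"
    have "(\<lambda>\<omega>. A k \<omega> i j) \<in> borel_measurable ?H" if "j < d" for i j
      unfolding half_past_def using that d k
      by (intro measurable_sigma_gen UnI1 UN_I[of k]) (auto simp: entries_A_def intro!: exI[of _ i] exI[of _ j])
    then have [measurable]: "(\<lambda>\<omega>. X d k \<omega> j) \<in> borel_measurable ?H" if "j < d" for j
      using that by (simp add: X_def)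
    have spH: "space ?H = space M" by (simp add: half_past_def)
    have [measurable]: "z k \<in> borel_measurable ?H"
      using z_meas sets_past_subset_half_past[OF k] by (auto simp: measurable_def spH)
    have "{\<omega> \<in> space ?H. good d k \<omega>} \<in> sets ?H" unfolding good_def by measurable
    moreover have "{\<omega> \<in> F. good d k \<omega>} = F \<inter> {\<omega> \<in> space ?H. good d k \<omega>}" using F_M by (auto simp: spH)
    ultimately show H: "{\<omega> \<in> F. good d k \<omega>} \<in> sets ?H"
      using F sets_past_subset_half_past[OF k] by auto
    then show "{\<omega> \<in> F. good d k \<omega>} \<in> events"
      using subalgebra_half_past[of k] by (auto simp: subalgebra_def)
  qed
  \<comment> \<open>Among the earlier failures a good embedding has relative probability at least
    \<open>c\<close>, and on that event the solver succeeds with relative probability at least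
    \<open>\<rho> k\<close>. The part where both happen leaves \<open>fail\<close>.\<close>
  have step: "prob (fail k) \<le> (1 - \<rho> k * c) * prob (fail (k - 1))"
    if k: "1 \<le> k" and d: "1 \<le> d" "d \<le> emb_dim dlb k" and c: "0 \<le> c"
      and ge: "\<And>w :: real^'e. norm w \<le> Rmax \<Longrightarrow> ennreal c \<le> emeasure (gauss_columns d) {a \<in> space (gauss_columns d). hits d a w s}"
    for k d c
  proof -
    let ?G = "{\<omega> \<in> fail (k - 1). good d k \<omega>}"
    have G: "?G \<in> events" "c * prob (fail (k - 1)) \<le> prob ?G" "?G \<in> sets (half_past M dlb A y p k)"
      using good_prob[OF k d fail_sets c ge] by auto
    have \<rho>k: "0 < \<rho> k" using \<rho>[OF k] \<rho>lb by auto
    have S_ev: "S k \<in> events"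
      using solver[OF k] \<rho>k by (intro sets_if_cond_exp_indicator_pos[of _ "half_past M dlb A y p k"])
        (auto simp: S_def elim!: eventually_mono)
    have "\<rho> k * c * prob (fail (k - 1)) \<le> \<rho> k * prob ?G" using G(2) \<rho>k by simp
    also have "\<dots> \<le> prob (?G \<inter> S k)"
      by (rule prob_Int_ge_if_cond_exp_ge[OF subalgebra_half_past _ \<rho>k _ G(3)])
        (use solver[OF k] in \<open>auto simp: S_def\<close>)
    also have "\<dots> \<le> prob (fail (k - 1) - fail k)"
    proof (rule finite_measure_mono)
      show "?G \<inter> S k \<subseteq> fail (k - 1) - fail k"
      proof
        fix \<omega> assume \<omega>: "\<omega> \<in> ?G \<inter> S k"
        then have "succ k \<omega>" by (intro good_S[OF _ d(2)]) auto
        then have "\<omega> \<notin> fail k" using k by (auto simp: fail_def)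
        with \<omega> show "\<omega> \<in> fail (k - 1) - fail k" by auto
      qed
    qed (use fail_events in auto)
    also have "\<dots> = prob (fail (k - 1)) - prob (fail k)"
      using fail_events by (intro finite_measure_Diff) (auto simp: fail_def)
    finally show ?thesis by (simp add: algebra_simps)
  qed
  have kmax1: "1 \<le> kmax" and emb_kmax: "emb_dim dlb kmax = CARD('e)"
    using dlb by (auto simp: kmax emb_dim_def)
  have full: "ennreal 1 \<le> emeasure (gauss_columns CARD('e)) {a \<in> space (gauss_columns CARD('e)). hits CARD('e) a w s}" for w :: "real^'e"
  proof -
    interpret C: prob_space "gauss_columns CARD('e) :: (nat \<Rightarrow> real^'e) measure" by (rule prob_space_gauss_columns)
    have DIM: "DIM(real^'e) = CARD('e)" by simp
    have "AE a in gauss_columns CARD('e). hits CARD('e) a w s"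
      using AE_gauss_columns_hits[where 'a = "real^'e", unfolded DIM] s(1) by (auto elim!: eventually_mono)
    then have "C.prob {a \<in> space (gauss_columns CARD('e)). hits CARD('e) a w s} = 1"
      by (subst C.prob_Collect_eq_1) auto
    then show ?thesis by (simp add: C.emeasure_eq_measure)
  qed
  \<comment> \<open>At \<open>kmax\<close> all columns are used and span almost surely, so c =
    1.\<close>
  have last: "prob (fail kmax) \<le> (1 - \<rho> kmax) * prob (fail (kmax - 1))"
    using step[OF kmax1 _ _ _ full] by (simp add: emb_kmax Suc_le_eq)
  have \<rho>max: "0 \<le> 1 - \<rho> kmax" using \<rho>[OF kmax1] by auto
  have part1: "\<rho> kmax \<le> 1 - prob (fail kmax)"
  proof -
    have "(1 - \<rho> kmax) * prob (fail (kmax - 1)) \<le> (1 - \<rho> kmax) * 1"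
      using \<rho>max by (intro mult_left_mono) auto
    then show ?thesis using last by simp
  qed
  \<comment> \<open>The guard means \<open>dlb < CARD('e)\<close>, the range in which
    \<open>tau\<close> is meaningful.\<close>
  have \<tau>: "0 < \<tau> \<and> \<tau> \<le> 1 \<and> (\<forall>k. 1 \<le> k \<longrightarrow> prob (fail k) \<le> (1 - \<rho>lb * \<tau>) * prob (fail (k - 1)))" if "1 < kmax"
  proof -
    have d: "dlb < CARD('e)" using that by (simp add: kmax)
    have r: "(\<epsilon> - lam) / (L * Rmax) = s / Rmax" by (simp add: s_def)
    have R: "0 < s / Rmax" "s / Rmax < 1" using s by auto
    have \<tau>01: "0 < \<tau>" "\<tau> \<le> 1"
      using tau_pos[OF R dlb(1) d] tau_le_1[OF dlb(1) _ R, where 'a = "real^'e"] d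
      by (auto simp: \<tau>_def r)
    have "prob (fail k) \<le> (1 - \<rho>lb * \<tau>) * prob (fail (k - 1))" if k: "1 \<le> k" for k
    proof -
      have "prob (fail k) \<le> (1 - \<rho> k * \<tau>) * prob (fail (k - 1))"
      proof (rule step[OF k dlb(1)])
        show "dlb \<le> emb_dim dlb k" by (simp add: emb_dim_def)
        show "0 \<le> \<tau>" using \<tau>01 by simp
        show "ennreal \<tau> \<le> emeasure (gauss_columns dlb) {a \<in> space (gauss_columns dlb). hits dlb a w s}"
          if "norm w \<le> Rmax" for w :: "real^'e"
          using emeasure_hits_ge_tau[OF dlb(1) _ s that] d by (simp add: \<tau>_def r)
      qed
      also have "\<dots> \<le> (1 - \<rho>lb * \<tau>) * prob (fail (k - 1))"
        using \<rho>[OF k] \<tau>01 by (intro mult_right_mono) auto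
      finally show ?thesis .
    qed
    then show ?thesis using \<tau>01 by simp
  qed
  have \<rho>lb1: "\<rho>lb \<le> 1" using \<rho>[of 1] by simp
  have q: "0 \<le> 1 - \<rho>lb * \<tau>" "1 - \<rho>lb * \<tau> < 1" if "1 < kmax"
    using \<tau>[OF that] \<rho>lb \<rho>lb1 by (auto intro: mult_le_one)
  have power: "prob (fail k) \<le> (1 - \<rho>lb * \<tau>) ^ k" if "1 < kmax" for k
  proof (induction k)
    case (Suc k)
    have "prob (fail (Suc k)) \<le> (1 - \<rho>lb * \<tau>) * prob (fail k)" using \<tau>[OF that] by (metis One_nat_def Suc_le_mono diff_Suc_1 zero_le)
    also have "\<dots> \<le> (1 - \<rho>lb * \<tau>) * (1 - \<rho>lb * \<tau>) ^ k" using q(1)[OF that] Suc.IH by (intro mult_left_mono)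
    finally show ?case by simp
  qed simp
  \<comment> \<open>As kmax - 1 is positive, failure before \<open>kmax\<close> has probability
    below 1; the positive factor 1 - \<open>\<rho> kmax\<close> keeps the inequality strict.\<close>
  have part2: "\<rho> kmax < 1 - prob (fail kmax)" if k: "1 < kmax" and lt: "\<rho> kmax < 1"
  proof -
    have "(1 - \<rho>lb * \<tau>) ^ (kmax - 1) < 1"
      using q[OF k] k by (subst power_less_one_iff) auto
    then have "prob (fail (kmax - 1)) < 1" using power[OF k, of "kmax - 1"] by simp
    then have "(1 - \<rho> kmax) * prob (fail (kmax - 1)) < (1 - \<rho> kmax) * 1"
      using lt by (intro mult_strict_left_mono) auto
    then show ?thesis using last by simp
  qed
  \<comment> \<open>Here no solver probability enters: the embedding is good almost surely, and
    \<open>good_min\<close> alone gives accuracy \<epsilon> - lam.\<close>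
  have part3: "prob (fail kmax) = 0"
    if ex: "AE \<omega> in M. f (iterate dlb A y p kmax \<omega>) = reduced_min_at f dlb A p kmax \<omega>"
  proof -
    let ?d = "CARD('e)"
    have "space M \<in> sets (past M dlb A y p (kmax - 1))"
      by (metis sets.top space_past)
    from good_prob[OF kmax1 _ _ this _ full] have good: "{\<omega> \<in> space M. good ?d kmax \<omega>} \<in> events"
        "1 \<le> prob {\<omega> \<in> space M. good ?d kmax \<omega>}"
      by (auto simp: emb_kmax Suc_le_eq prob_space)
    then have "AE \<omega> in M. good ?d kmax \<omega>"
      using prob_Collect_eq_1[OF good(1)] prob_le_1[of "{\<omega> \<in> space M. good ?d kmax \<omega>}"] by auto
    with ex have "AE \<omega> in M. \<omega> \<notin> fail kmax"
    proof eventually_elim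
      case (elim \<omega>)
      have "succ kmax \<omega>"
        using good_min[OF elim(2)] elim(1) tolerance by (simp add: emb_kmax succ_def)
      then show ?case using kmax1 by (auto simp: fail_def)
    qed
    then show ?thesis using prob_eq_0[OF fail_events, of kmax] by simp
  qed
  show ?thesis
    unfolding prob_opt[OF kmax1] \<tau>_def[symmetric]
    using part1 part2 part3 power prob_opt by auto
qed

end
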